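(* Let $S$ be a structure on a vector bundle $V$. Let $\sigma\in\Gamma(\wedge^2V)$ be a non-degenerate bivector with inverse $\tau\in\Gamma(\wedge^2V^* )$. Then $\sigma$ is a Poisson function with respect to $S$ if and only if $-\tau$ is a symplectic function with respect to $S$.
   Context: Let $V\to M$ be a smooth real vector bundle of finite rank over a manifold, and $X=T^*\Pi V$ the bigraded supermanifold which is the cotangent bundle of $\Pi V$ ($V$ with parity of the fibers reversed). Local coordinates on $X$: $(x^i,\xi^a,p_i,\theta_a)$ of bidegrees $(0,0),(0,1),(1,1),(1,0)$, where $(x^i)$ are coordinates on $M$, $(\xi^a)$ are fiber coordinates on $\Pi V$ (a local frame of $V^*$), $(\theta_a)$ their conjugates (identified with the dual local frame of $V$). $\mathcal F$ is the bigraded supercommutative algebra of functions on $X$; an element of bidegree $(k,\ell)$ has degree $|u|=k+\ell$, shifted bidegree $(k-1,\ell-1)$, and shifted degree $\|u\|=k+\ell-2$. The big bracket $\{\ ,\ \}$ is the canonical even Poisson bracket on $\mathcal F$, of shifted bidegree $(0,0)$, with $\{x^i,p_j\}=\delta^i_j=-\{p_j,x^i\}$, $\{\xi^a,\theta_b\}=\delta^a_b=\{\theta_b,\xi^a\}$, all other brackets of coordinates being zero; it satisfies $\{u,v\}=-(-1)^{\|u\|\|v\|}\{v,u\}$, $\{u,vw\}=\{u,v\}w+(-1)^{|u||v|}v\{u,w\}$ and $\{u,\{v,w\}\}=\{\{u,v\},w\}+(-1)^{\|u\|\|v\|}\{v,\{u,w\}\}$. A structure on $V$ is $S\in\mathcal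 F$ of degree $3$ (shifted degree $1$) with $\{S,S\}=0$. Write $S=\phi+\gamma+\mu+\psi$ with components of shifted bidegrees $(2,-1),(1,0),(0,1),(-1,2)$ respectively. Elements of shifted bidegree $(1,-1)$ are bivectors $\sigma=\frac12\sigma^{ab}\theta_a\theta_b\in\Gamma(\wedge^2V)$; elements of shifted bidegree $(-1,1)$ are 2-forms $\tau=\frac12\tau_{ab}\xi^a\xi^b\in\Gamma(\wedge^2V^* )$. $\sigma$ is a Poisson function with respect to $S$ if $$\phi-\{\gamma,\sigma\}+\tfrac12\{\{\mu,\sigma\},\sigma\}-\tfrac16\{\{\{\psi,\sigma\},\sigma\},\sigma\}=0 .$$ $\tau$ is a pre-symplectic function with respect to $S$ if $$\psi-\{\mu,\tau\}+\tfrac12\{\{\gamma,\tau\},\tau\}-\tfrac16\{\{\{\phi,\tau\},\tau\},\tau\}=0 .$$ A symplectic function is a non-degenerate pre-symplectic function. $\sigma$ is non-degenerate if $\sigma^\sharp:V^*\to V$, $\sigma^\sharp\alpha=i_\alpha\sigma$ (locally $\alpha_a\sigma^{ab}\theta_b$), is invertible. Its inverse is the 2-form $\tau$ such that $\tau^\flat:=(\sigma^\sharp)^{-1}$ satisfies $\tau^\flat X=-i_X\tau$ for $X\in\Gamma(V)$ (locally $i_X\tau=X^a\tau_{ab}\xi^b$). *)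

theory Defs
  imports "HOL-Analysis.Analysis" "HOL-Library.Multiset"
begin

section \<open>Smooth functions on open subsets of Euclidean space\<close>

text \<open>
  The space of dimension \<open>n\<close> is the library's \<open>Euclidean_space n\<close>: the functions
  \<open>nat \<Rightarrow> real\<close> that vanish at every index \<open>\<ge> n\<close>. It includes \<open>n = 0\<close>.
\<close>

definition partial :: "nat \<Rightarrow> ((nat \<Rightarrow> real) \<Rightarrow> real) \<Rightarrow> (nat \<Rightarrow> real) \<Rightarrow> real" where
  "partial i f x = deriv (\<lambda>t. f (x(i := t))) (x i)"

text \<open>Smoothness: the partial derivatives of all orders exist and are continuous.\<close>

definition smooth_on :: "nat \<Rightarrow> (nat \<Rightarrow> real) set \<Rightarrow> ((nat \<Rightarrow> real) \<Rightarrow> real) \<Rightarrow> bool" where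
  "smooth_on n U f \<longleftrightarrow>
     (\<forall>is \<in> lists {..<n}.
        continuous_map (subtopology (Euclidean_space n) U) euclideanreal (foldr partial is f) \<and>
        (\<forall>i<n. \<forall>x\<in>U. (\<lambda>t. foldr partial is f (x(i := t))) differentiable at (x i)))"


section \<open>Smooth vector bundles\<close>

text \<open>
  A bundle chart is a coordinate chart of the base together with a local frame over the
  same open set. The fibres are subspaces of an ambient real vector space \<open>'v\<close>, possibly
  infinite-dimensional; every vector bundle is of this form, e.g. inside the algebraic
  direct sum of its fibres. Fibres over different points may overlap in \<open>'v\<close>; the total
  space is \<open>Sigma (topspace (base V)) (fibre V)\<close>.
\<close>

record ('m, 'v) bundle_chart =
  cdom :: "'m set"
  coord :: "'m \<Rightarrow> nat \<Rightarrow> real"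
  frame :: "nat \<Rightarrow> 'm \<Rightarrow> 'v"

record ('m, 'v) vbundle =
  base :: "'m topology"
  bdim :: nat
  vrank :: nat
  fibre :: "'m \<Rightarrow> 'v set"
  charts :: "('m, 'v) bundle_chart set"

definition frame_set :: "nat \<Rightarrow> ('m, 'v) bundle_chart \<Rightarrow> 'm \<Rightarrow> 'v set" where
  "frame_set r c p = (\<lambda>a. frame c a p) ` {..<r}"

definition coframe :: "nat \<Rightarrow> ('m, 'v::real_vector) bundle_chart \<Rightarrow> nat \<Rightarrow> 'm \<Rightarrow> 'v \<Rightarrow> real" where
  "coframe r c a p X = representation (frame_set r c p) X (frame c a p)"

definition in_chart :: "('m, 'v) bundle_chart \<Rightarrow> ('m \<Rightarrow> real) \<Rightarrow> (nat \<Rightarrow> real) \<Rightarrow> real" where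
  "in_chart c f x = f (inv_into (cdom c) (coord c) x)"

definition smooth_in_chart :: "nat \<Rightarrow> ('m, 'v) bundle_chart \<Rightarrow> 'm set \<Rightarrow> ('m \<Rightarrow> real) \<Rightarrow> bool" where
  "smooth_in_chart n c W f \<longleftrightarrow> smooth_on n (coord c ` W) (in_chart c f)"

definition dcoord :: "('m, 'v) bundle_chart \<Rightarrow> nat \<Rightarrow> ('m \<Rightarrow> real) \<Rightarrow> 'm \<Rightarrow> real" where
  "dcoord c i f p = partial i (in_chart c f) (coord c p)"

text \<open>
  The matrix of the change of frame: \<open>\<xi>\<^sub>d\<^sup>a = (\<Sum>b. change_frame r c d a b * \<xi>\<^sub>c\<^sup>b)\<close> for the
  dual frames, equivalently \<open>frame c b = (\<Sum>a. change_frame r c d a b * frame d a)\<close>.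
\<close>

definition change_frame ::
    "nat \<Rightarrow> ('m, 'v::real_vector) bundle_chart \<Rightarrow> ('m, 'v) bundle_chart \<Rightarrow> nat \<Rightarrow> nat \<Rightarrow> 'm \<Rightarrow> real" where
  "change_frame r c d a b p = coframe r d a p (frame c b p)"

definition smooth_vector_bundle :: "('m, 'v::real_vector) vbundle \<Rightarrow> bool" where
  "smooth_vector_bundle V \<longleftrightarrow>
     Hausdorff_space (base V) \<and> second_countable (base V) \<and>
     \<Union> (cdom ` charts V) = topspace (base V) \<and>
     (\<forall>c \<in> charts V.
        openin (base V) (cdom c) \<and>
        openin (Euclidean_space (bdim V)) (coord c ` cdom c) \<and>
        homeomorphic_map (subtopology (base V) (cdom c))
          (subtopology (Euclidean_space (bdim V)) (coord c ` cdom c)) (coord c) \<and>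
        (\<forall>p \<in> cdom c.
           inj_on (\<lambda>a. frame c a p) {..<vrank V} \<and>
           independent (frame_set (vrank V) c p) \<and>
           span (frame_set (vrank V) c p) = fibre V p)) \<and>
     (\<forall>c \<in> charts V. \<forall>d \<in> charts V.
        (\<forall>i < bdim V. smooth_in_chart (bdim V) c (cdom c \<inter> cdom d) (\<lambda>p. coord d p i)) \<and>
        (\<forall>a < vrank V. \<forall>b < vrank V.
           smooth_in_chart (bdim V) c (cdom c \<inter> cdom d) (change_frame (vrank V) c d a b)))"


section \<open>Superpolynomials in the fibre coordinates\<close>

text \<open>
  The triple \<open>(A, B, K)\<close> stands for the monomial \<open>\<xi>^A \<theta>_B p_K\<close>, i.e. the product of the
  \<open>\<xi>\<^sup>a\<close> with \<open>a \<in> A\<close> in increasing order, then the \<open>\<theta>\<^sub>b\<close> with \<open>b \<in> B\<close> in increasing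
  order, then the \<open>p\<^sub>i\<close> with \<open>i \<in># K\<close>. A superpolynomial is given by its coefficients.
\<close>

type_synonym smono = "nat set \<times> nat set \<times> nat multiset"
type_synonym spoly = "smono \<Rightarrow> real"

definition valid_mono :: "nat \<Rightarrow> nat \<Rightarrow> smono \<Rightarrow> bool" where
  "valid_mono n r = (\<lambda>(A, B, K). A \<subseteq> {..<r} \<and> B \<subseteq> {..<r} \<and> set_mset K \<subseteq> {..<n})"

text \<open>Bidegrees of \<open>\<xi>\<^sup>a\<close>, \<open>\<theta>\<^sub>a\<close>, \<open>p\<^sub>i\<close> are \<open>(0,1)\<close>, \<open>(1,0)\<close>, \<open>(1,1)\<close>.\<close>

definition bidegree :: "smono \<Rightarrow> nat \<times> nat" where
  "bidegree = (\<lambda>(A, B, K). (card B + size K, card A + size K))"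

definition shifted_bidegree :: "smono \<Rightarrow> int \<times> int" where
  "shifted_bidegree m = (int (fst (bidegree m)) - 1, int (snd (bidegree m)) - 1)"

definition degree_of :: "smono \<Rightarrow> nat" where
  "degree_of m = fst (bidegree m) + snd (bidegree m)"

definition inversions :: "nat set \<Rightarrow> nat set \<Rightarrow> nat" where
  "inversions A B = card {(i, j). i \<in> A \<and> j \<in> B \<and> j < i}"

definition smono_sign :: "nat set \<Rightarrow> nat set \<Rightarrow> nat set \<Rightarrow> nat set \<Rightarrow> real" where
  "smono_sign A B A' B' = (- 1) ^ (card B * card A' + inversions A A' + inversions B B')"

definition smult :: "spoly \<Rightarrow> spoly \<Rightarrow> spoly" where
  "smult u v = (\<lambda>(A, B, K).
     \<Sum>A'\<in>Pow A. \<Sum>B'\<in>Pow B. \<Sum>K' | K' \<subseteq># K.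
       smono_sign A' B' (A - A') (B - B') * u (A', B', K') * v (A - A', B - B', K - K'))"

definition smonom :: "smono \<Rightarrow> spoly" where
  "smonom m = (\<lambda>m'. if m' = m then 1 else 0)"

abbreviation sone :: spoly where "sone \<equiv> smonom ({}, {}, {#})"
abbreviation sxi :: "nat \<Rightarrow> spoly" where "sxi a \<equiv> smonom ({a}, {}, {#})"
abbreviation stheta :: "nat \<Rightarrow> spoly" where "stheta a \<equiv> smonom ({}, {a}, {#})"
abbreviation smom :: "nat \<Rightarrow> spoly" where "smom i \<equiv> smonom ({}, {}, {#i#})"

text \<open>Left (\<open>l\<close>) and right (\<open>r\<close>) derivatives in the odd variables, and the derivative in \<open>p\<^sub>i\<close>.\<close>

definition lxi :: "nat \<Rightarrow> spoly \<Rightarrow> spoly" where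
  "lxi a u = (\<lambda>(A, B, K).
     if a \<in> A then 0 else (- 1) ^ card {i \<in> A. i < a} * u (insert a A, B, K))"

definition rxi :: "nat \<Rightarrow> spoly \<Rightarrow> spoly" where
  "rxi a u = (\<lambda>(A, B, K).
     if a \<in> A then 0 else (- 1) ^ (card {i \<in> A. a < i} + card B) * u (insert a A, B, K))"

definition ltheta :: "nat \<Rightarrow> spoly \<Rightarrow> spoly" where
  "ltheta a u = (\<lambda>(A, B, K).
     if a \<in> B then 0 else (- 1) ^ (card A + card {i \<in> B. i < a}) * u (A, insert a B, K))"

definition rtheta :: "nat \<Rightarrow> spoly \<Rightarrow> spoly" where
  "rtheta a u = (\<lambda>(A, B, K).
     if a \<in> B then 0 else (- 1) ^ card {i \<in> B. a < i} * u (A, insert a B, K))"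

definition dmom :: "nat \<Rightarrow> spoly \<Rightarrow> spoly" where
  "dmom i u = (\<lambda>(A, B, K). real (count K i + 1) * u (A, B, add_mset i K))"

definition ssubst :: "(nat \<Rightarrow> spoly) \<Rightarrow> (nat \<Rightarrow> spoly) \<Rightarrow> (nat \<Rightarrow> spoly) \<Rightarrow> spoly \<Rightarrow> spoly" where
  "ssubst X T P u = (\<lambda>m. \<Sum>(A, B, K) | u (A, B, K) \<noteq> 0. u (A, B, K) *
     foldr smult (map X (sorted_list_of_set A) @ map T (sorted_list_of_set B) @
                  map P (sorted_list_of_multiset K)) sone m)"


section \<open>Functions on the cotangent bundle of the parity-reversed bundle\<close>

text \<open>
  A function on \<open>X = T\<^sup>*\<Pi>V\<close> is given by its expressions in the charts: in the chart \<open>c\<close>,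
  at the base point \<open>p\<close>, a superpolynomial in the fibre coordinates \<open>\<xi>\<^sup>a\<close>, \<open>\<theta>\<^sub>a\<close>, \<open>p\<^sub>i\<close>
  belonging to \<open>c\<close>.
\<close>

type_synonym ('m, 'v) superfun = "('m, 'v) bundle_chart \<Rightarrow> 'm \<Rightarrow> spoly"

text \<open>
  Coordinate change from \<open>c\<close> to \<open>d\<close>. With \<open>\<xi>\<^sub>d\<^sup>a = \<Sum>b. G\<^sup>a\<^sub>b \<xi>\<^sub>c\<^sup>b\<close>, where \<open>G\<close> is
  \<open>change_frame r c d\<close>, the momenta conjugate to the coordinates \<open>(x, \<xi>)\<close> of \<open>\<Pi>V\<close> transform as
  \<open>\<theta>\<^sub>c\<^sub>b = \<Sum>a. G\<^sup>a\<^sub>b \<theta>\<^sub>d\<^sub>a\<close> and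
  \<open>p\<^sub>c\<^sub>k = (\<Sum>j. \<partial>x\<^sub>d\<^sup>j/\<partial>x\<^sub>c\<^sup>k p\<^sub>d\<^sub>j) - (\<Sum>a b. \<partial>G\<^sup>a\<^sub>b/\<partial>x\<^sub>c\<^sup>k \<xi>\<^sub>c\<^sup>b \<theta>\<^sub>d\<^sub>a)\<close>. These are the
  transformations for which the canonical bracket relations hold in both charts.
\<close>

definition xi_subst ::
    "nat \<Rightarrow> ('m, 'v::real_vector) bundle_chart \<Rightarrow> ('m, 'v) bundle_chart \<Rightarrow> 'm \<Rightarrow> nat \<Rightarrow> spoly" where
  "xi_subst r c d p b = (\<lambda>m. \<Sum>e<r. change_frame r d c b e p * sxi e m)"

definition theta_subst ::
    "nat \<Rightarrow> ('m, 'v::real_vector) bundle_chart \<Rightarrow> ('m, 'v) bundle_chart \<Rightarrow> 'm \<Rightarrow> nat \<Rightarrow> spoly" where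
  "theta_subst r c d p b = (\<lambda>m. \<Sum>a<r. change_frame r c d a b p * stheta a m)"

definition mom_subst ::
    "nat \<Rightarrow> nat \<Rightarrow> ('m, 'v::real_vector) bundle_chart \<Rightarrow> ('m, 'v) bundle_chart \<Rightarrow> 'm \<Rightarrow> nat \<Rightarrow> spoly" where
  "mom_subst n r c d p k = (\<lambda>m.
     (\<Sum>j<n. dcoord c k (\<lambda>q. coord d q j) p * smom j m) -
     (\<Sum>a<r. \<Sum>b<r. dcoord c k (change_frame r c d a b) p *
                      smult (xi_subst r c d p b) (stheta a) m))"

definition chart_change ::
    "nat \<Rightarrow> nat \<Rightarrow> ('m, 'v::real_vector) bundle_chart \<Rightarrow> ('m, 'v) bundle_chart \<Rightarrow> 'm \<Rightarrow> spoly \<Rightarrow> spoly" where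
  "chart_change n r c d p = ssubst (xi_subst r c d p) (theta_subst r c d p) (mom_subst n r c d p)"

text \<open>
  The algebra of functions on \<open>X\<close>. The degree bound makes the algebra the direct sum of its
  bidegree components. The last condition fixes the irrelevant values of a representative.
\<close>

definition superfuns :: "('m, 'v::real_vector) vbundle \<Rightarrow> ('m, 'v) superfun set" where
  "superfuns V = {u.
     (\<forall>c \<in> charts V. \<forall>p \<in> cdom c. \<forall>m. u c p m \<noteq> 0 \<longrightarrow> valid_mono (bdim V) (vrank V) m) \<and>
     (\<exists>N. \<forall>c \<in> charts V. \<forall>p \<in> cdom c. \<forall>m. u c p m \<noteq> 0 \<longrightarrow> degree_of m \<le> N) \<and>
     (\<forall>c \<in> charts V. \<forall>m. smooth_in_chart (bdim V) c (cdom c) (\<lambda>p. u c p m)) \<and>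
     (\<forall>c \<in> charts V. \<forall>d \<in> charts V. \<forall>p \<in> cdom c \<inter> cdom d.
        u d p = chart_change (bdim V) (vrank V) c d p (u c p)) \<and>
     (\<forall>c p. c \<notin> charts V \<or> p \<notin> cdom c \<longrightarrow> u c p = (\<lambda>m. 0))}"

definition has_shifted_bidegree :: "int \<times> int \<Rightarrow> ('m, 'v) superfun \<Rightarrow> bool" where
  "has_shifted_bidegree kl u \<longleftrightarrow> (\<forall>c p m. u c p m \<noteq> 0 \<longrightarrow> shifted_bidegree m = kl)"

definition has_degree :: "nat \<Rightarrow> ('m, 'v) superfun \<Rightarrow> bool" where
  "has_degree k u \<longleftrightarrow> (\<forall>c p m. u c p m \<noteq> 0 \<longrightarrow> degree_of m = k)"

definition component :: "int \<times> int \<Rightarrow> ('m, 'v) superfun \<Rightarrow> ('m, 'v) superfun" where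
  "component kl u = (\<lambda>c p m. if shifted_bidegree m = kl then u c p m else 0)"


section \<open>The big bracket\<close>

text \<open>
  In a chart,
  \<open>{u,v} = (\<Sum>i. \<partial>u/\<partial>x\<^sup>i \<partial>v/\<partial>p\<^sub>i - \<partial>u/\<partial>p\<^sub>i \<partial>v/\<partial>x\<^sup>i)\<close>
  \<open>+ (\<Sum>a. (right \<partial>u/\<partial>\<xi>\<^sup>a) (left \<partial>v/\<partial>\<theta>\<^sub>a) + (right \<partial>u/\<partial>\<theta>\<^sub>a) (left \<partial>v/\<partial>\<xi>\<^sup>a))\<close>,
  the solution of \<open>{u,vw} = {u,v}w + (-1)^(|u||v|) v{u,w}\<close> and
  \<open>{u,v} = -(-1)^(|u||v|) {v,u}\<close> with \<open>{x\<^sup>i,p\<^sub>j} = \<delta>\<^sup>i\<^sub>j\<close> and \<open>{\<xi>\<^sup>a,\<theta>\<^sub>b} = \<delta>\<^sup>a\<^sub>b\<close>, all other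
  brackets of coordinates (except the transposed ones) being zero.
\<close>

definition dx :: "('m, 'v) bundle_chart \<Rightarrow> nat \<Rightarrow> ('m \<Rightarrow> spoly) \<Rightarrow> 'm \<Rightarrow> spoly" where
  "dx c i u p = (\<lambda>m. dcoord c i (\<lambda>q. u q m) p)"

definition local_bracket ::
    "nat \<Rightarrow> nat \<Rightarrow> ('m, 'v) bundle_chart \<Rightarrow> ('m \<Rightarrow> spoly) \<Rightarrow> ('m \<Rightarrow> spoly) \<Rightarrow> 'm \<Rightarrow> spoly" where
  "local_bracket n r c u v p = (\<lambda>m.
     (\<Sum>i<n. smult (dx c i u p) (dmom i (v p)) m - smult (dmom i (u p)) (dx c i v p) m) +
     (\<Sum>a<r. smult (rxi a (u p)) (ltheta a (v p)) m + smult (rtheta a (u p)) (lxi a (v p)) m))"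

definition big_bracket ::
    "('m, 'v) vbundle \<Rightarrow> ('m, 'v) superfun \<Rightarrow> ('m, 'v) superfun \<Rightarrow> ('m, 'v) superfun" where
  "big_bracket V u v = (\<lambda>c p m.
     if c \<in> charts V \<and> p \<in> cdom c then local_bracket (bdim V) (vrank V) c (u c) (v c) p m else 0)"


section \<open>Structures, Poisson functions and symplectic functions\<close>

definition structure_on :: "('m, 'v::real_vector) vbundle \<Rightarrow> ('m, 'v) superfun \<Rightarrow> bool" where
  "structure_on V S \<longleftrightarrow>
     S \<in> superfuns V \<and> has_degree 3 S \<and> big_bracket V S S = (\<lambda>c p m. 0)"

definition bivector :: "('m, 'v::real_vector) vbundle \<Rightarrow> ('m, 'v) superfun \<Rightarrow> bool" where
  "bivector V \<sigma> \<longleftrightarrow> \<sigma> \<in> superfuns V \<and> has_shifted_bidegree (1, -1) \<sigma>"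

definition two_form :: "('m, 'v::real_vector) vbundle \<Rightarrow> ('m, 'v) superfun \<Rightarrow> bool" where
  "two_form V \<tau> \<longleftrightarrow> \<tau> \<in> superfuns V \<and> has_shifted_bidegree (-1, 1) \<tau>"

text \<open>The skew-symmetric matrices in \<open>\<sigma> = 1/2 \<sigma>\<^sup>a\<^sup>b\<theta>\<^sub>a\<theta>\<^sub>b\<close> and \<open>\<tau> = 1/2 \<tau>\<^sub>a\<^sub>b\<xi>\<^sup>a\<xi>\<^sup>b\<close>.\<close>

definition bivector_matrix ::
    "('m, 'v) superfun \<Rightarrow> ('m, 'v) bundle_chart \<Rightarrow> 'm \<Rightarrow> nat \<Rightarrow> nat \<Rightarrow> real" where
  "bivector_matrix \<sigma> c p a b =
     (if a < b then \<sigma> c p ({}, {a, b}, {#}) else if b < a then - \<sigma> c p ({}, {a, b}, {#}) else 0)"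

definition form_matrix ::
    "('m, 'v) superfun \<Rightarrow> ('m, 'v) bundle_chart \<Rightarrow> 'm \<Rightarrow> nat \<Rightarrow> nat \<Rightarrow> real" where
  "form_matrix \<tau> c p a b =
     (if a < b then \<tau> c p ({a, b}, {}, {#}) else if b < a then - \<tau> c p ({a, b}, {}, {#}) else 0)"

text \<open>
  Linear functionals on a fibre, made unique as HOL functions by extensionality outside the
  fibre (the fibre need not be all of \<open>'v\<close>).
\<close>

definition dual_fibre :: "('m, 'v::real_vector) vbundle \<Rightarrow> 'm \<Rightarrow> ('v \<Rightarrow> real) set" where
  "dual_fibre V p = {\<alpha> \<in> extensional (fibre V p).
     (\<forall>X \<in> fibre V p. \<forall>Y \<in> fibre V p. \<alpha> (X + Y) = \<alpha> X + \<alpha> Y) \<and>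
     (\<forall>t. \<forall>X \<in> fibre V p. \<alpha> (t *\<^sub>R X) = t * \<alpha> X)}"

text \<open>
  \<open>\<sigma>\<^sup>\<sharp> \<alpha> = \<alpha>\<^sub>a \<sigma>\<^sup>a\<^sup>b \<theta>\<^sub>b\<close> and \<open>\<tau>\<^sup>\<flat> X = - X\<^sup>a \<tau>\<^sub>a\<^sub>b \<xi>\<^sup>b\<close> (note the sign), with \<open>\<theta>\<^sub>b\<close> read as the
  frame of the fibre and \<open>\<xi>\<^sup>b\<close> as the dual frame. They do not depend on the chart \<open>c\<close> at \<open>p\<close>.
\<close>

definition sharp ::
    "('m, 'v::real_vector) vbundle \<Rightarrow> ('m, 'v) superfun \<Rightarrow> ('m, 'v) bundle_chart \<Rightarrow> 'm \<Rightarrow> ('v \<Rightarrow> real) \<Rightarrow> 'v" where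
  "sharp V \<sigma> c p \<alpha> =
     (\<Sum>a<vrank V. \<Sum>b<vrank V. (\<alpha> (frame c a p) * bivector_matrix \<sigma> c p a b) *\<^sub>R frame c b p)"

definition flat ::
    "('m, 'v::real_vector) vbundle \<Rightarrow> ('m, 'v) superfun \<Rightarrow> ('m, 'v) bundle_chart \<Rightarrow> 'm \<Rightarrow> 'v \<Rightarrow> 'v \<Rightarrow> real" where
  "flat V \<tau> c p X = restrict (\<lambda>Y.
     - (\<Sum>a<vrank V. \<Sum>b<vrank V.
          coframe (vrank V) c a p X * form_matrix \<tau> c p a b * coframe (vrank V) c b p Y)) (fibre V p)"

definition nondegenerate_bivector :: "('m, 'v::real_vector) vbundle \<Rightarrow> ('m, 'v) superfun \<Rightarrow> bool" where
  "nondegenerate_bivector V \<sigma> \<longleftrightarrow>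
     (\<forall>c \<in> charts V. \<forall>p \<in> cdom c. bij_betw (sharp V \<sigma> c p) (dual_fibre V p) (fibre V p))"

definition nondegenerate_form :: "('m, 'v::real_vector) vbundle \<Rightarrow> ('m, 'v) superfun \<Rightarrow> bool" where
  "nondegenerate_form V \<tau> \<longleftrightarrow>
     (\<forall>c \<in> charts V. \<forall>p \<in> cdom c. bij_betw (flat V \<tau> c p) (fibre V p) (dual_fibre V p))"

definition is_inverse_form ::
    "('m, 'v::real_vector) vbundle \<Rightarrow> ('m, 'v) superfun \<Rightarrow> ('m, 'v) superfun \<Rightarrow> bool" where
  "is_inverse_form V \<sigma> \<tau> \<longleftrightarrow>
     (\<forall>c \<in> charts V. \<forall>p \<in> cdom c. \<forall>X \<in> fibre V p.
        flat V \<tau> c p X = inv_into (dual_fibre V p) (sharp V \<sigma> c p) X)"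

definition poisson_function ::
    "('m, 'v::real_vector) vbundle \<Rightarrow> ('m, 'v) superfun \<Rightarrow> ('m, 'v) superfun \<Rightarrow> bool" where
  "poisson_function V S \<sigma> \<longleftrightarrow> bivector V \<sigma> \<and>
     (let \<phi> = component (2, -1) S; \<gamma> = component (1, 0) S;
          \<mu> = component (0, 1) S; \<psi> = component (-1, 2) S;
          br = big_bracket V
      in \<forall>c p m. \<phi> c p m - br \<gamma> \<sigma> c p m + 1/2 * br (br \<mu> \<sigma>) \<sigma> c p m
                  - 1/6 * br (br (br \<psi> \<sigma>) \<sigma>) \<sigma> c p m = 0)"

definition presymplectic_function ::
    "('m, 'v::real_vector) vbundle \<Rightarrow> ('m, 'v) superfun \<Rightarrow> ('m, 'v) superfun \<Rightarrow> bool" where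
  "presymplectic_function V S \<tau> \<longleftrightarrow> two_form V \<tau> \<and>
     (let \<phi> = component (2, -1) S; \<gamma> = component (1, 0) S;
          \<mu> = component (0, 1) S; \<psi> = component (-1, 2) S;
          br = big_bracket V
      in \<forall>c p m. \<psi> c p m - br \<mu> \<tau> c p m + 1/2 * br (br \<gamma> \<tau>) \<tau> c p m
                  - 1/6 * br (br (br \<phi> \<tau>) \<tau>) \<tau> c p m = 0)"

definition symplectic_function ::
    "('m, 'v::real_vector) vbundle \<Rightarrow> ('m, 'v) superfun \<Rightarrow> ('m, 'v) superfun \<Rightarrow> bool" where
  "symplectic_function V S \<tau> \<longleftrightarrow> presymplectic_function V S \<tau> \<and> nondegenerate_form V \<tau>"

end

theory Submission
  imports Defs "HOL-Library.Function_Algebras"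
begin

text \<open>
  Both equations are pointwise linear algebra. Bracketing with the bivector \<open>\<sigma>\<close> or with the
  2-form \<open>-\<tau>\<close> never differentiates the other argument along the base, so at each point of a
  chart \<open>E = {\<cdot>, \<sigma>}\<close> and \<open>F = {\<cdot>, -\<tau>}\<close> are linear operators on superpolynomials in the fibre
  coordinates. \<open>E\<close> sends bidegree \<open>(k, l)\<close> to \<open>(k + 1, l - 1)\<close>, \<open>F\<close> goes back, and because \<open>\<sigma>\<close> and
  \<open>-\<tau>\<close> are inverse matrices
    \<open>E F - F E = k - l\<close>  on bidegree \<open>(k, l)\<close>:
  \<open>E\<close>, \<open>F\<close> generate an action of \<open>sl\<^sub>2\<close> whose weight is the number of \<open>\<theta>\<close>'s minus the number of
  \<open>\<xi>\<close>'s.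

  Functions of degree 3 have weights 3, 1, -1, -3, carried by \<open>\<phi>\<close>, \<open>\<gamma>\<close>, \<open>\<mu>\<close>, \<open>\<psi>\<close>. The Poisson equation
  for \<open>\<sigma>\<close> says that the top component \<open>P\<close> of \<open>exp(-E) S\<close> vanishes, the pre-symplectic equation for
  \<open>-\<tau>\<close> that the bottom component \<open>Q\<close> of \<open>exp(-F) S\<close> does. The Weyl element
  \<open>w = exp(E) exp(-F) exp(E)\<close> of \<open>SL\<^sub>2\<close> maps weight \<open>j\<close> to weight \<open>-j\<close>, and raising operators do not reach
  the bottom component; hence \<open>Q\<close> is also the bottom component of \<open>exp(E) exp(-F) S = w exp(-E) S\<close>,
  that is, \<open>Q = w P\<close>. On weight 3, \<open>w\<close> is \<open>-F\<^sup>3/6\<close>. The proof avoids the exponentials and computes directly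
  that \<open>F\<^sup>3 P = -6 Q\<close> and \<open>E\<^sup>3 Q = -6 P\<close> (lemma \<open>cube_lowering_top_component\<close>), so \<open>P = 0\<close> if and only
  if \<open>Q = 0\<close>.

  The commutator is computed in lemma \<open>quad_bracket_commutator\<close> from the canonical anticommutation
  relations between right multiplications by the odd coordinates and the right derivatives. The
  momenta \<open>p\<^sub>i\<close> contribute additional terms with \<open>\<partial>\<^sub>i\<sigma>\<close> and \<open>\<partial>\<^sub>i\<tau>\<close>; they cancel by
  \<open>(\<partial>\<^sub>i\<sigma>)\<tau> + \<sigma>(\<partial>\<^sub>i\<tau>) = 0\<close>, the derivative of the inverse relation (lemma
  \<open>derivative_of_inverse_relation\<close>).
\<close>

section \<open>A relation in representations of sl(2) with weights 3, 1, -1, -3\<close>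

text \<open>
  Here \<open>U k l\<close> plays the part of bidegree \<open>(k, l)\<close>, of weight \<open>k - l\<close>. Commuting the \<open>F\<close>'s to the right
  past the \<open>E\<close>'s, until they kill the lowest weight, turns \<open>F\<^sup>3 E \<gamma>\<close>, \<open>F\<^sup>3 E\<^sup>2 \<mu>\<close>, \<open>F\<^sup>3 E\<^sup>3 \<psi>\<close> into
  \<open>3 F\<^sup>2 \<gamma>\<close>, \<open>12 F \<mu>\<close>, \<open>36 \<psi>\<close>; with the coefficients of the exponential series all terms acquire
  the common factor -6.
\<close>

lemma cube_lowering_top_component:
  fixes E F :: "'a::real_vector \<Rightarrow> 'a" and U :: "nat \<Rightarrow> nat \<Rightarrow> 'a set"
  assumes lin: "linear E" "linear F"
    and E: "\<And>k l u. u \<in> U k (Suc l) \<Longrightarrow> E u \<in> U (Suc k) l"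
    and F: "\<And>k l u. u \<in> U (Suc k) l \<Longrightarrow> F u \<in> U k (Suc l)"
    and F0: "\<And>l u. u \<in> U 0 l \<Longrightarrow> F u = 0"
    and comm: "\<And>k l u. u \<in> U k l \<Longrightarrow> E (F u) - F (E u) = (real k - real l) *\<^sub>R u"
    and S: "\<phi> \<in> U 3 0" "\<gamma> \<in> U 2 1" "\<mu> \<in> U 1 2" "\<psi> \<in> U 0 3"
  shows "F (F (F (\<phi> - E \<gamma> + (1/2) *\<^sub>R E (E \<mu>) - (1/6) *\<^sub>R E (E (E \<psi>))))) =
    (-6) *\<^sub>R (\<psi> - F \<mu> + (1/2) *\<^sub>R F (F \<gamma>) - (1/6) *\<^sub>R F (F (F \<phi>)))"
proof -
  note U_nums = numeral_2_eq_2 numeral_3_eq_3 One_nat_def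
  have FE: "F (E u) = E (F u) + (real l - real k) *\<^sub>R u" if "u \<in> U k l" for k l u
    using comm[OF that] by (simp add: algebra_simps)
  note simps = linear_0[OF lin(1)] linear_0[OF lin(2)] linear_add[OF lin(1)] linear_add[OF lin(2)]
    linear_diff[OF lin(2)] linear_scale[OF lin(1)] linear_scale[OF lin(2)]
  have \<gamma>: "F (F (F (E \<gamma>))) = 3 *\<^sub>R F (F \<gamma>)"
  proof -
    have U: "F \<gamma> \<in> U 1 2" "F (F \<gamma>) \<in> U 0 3"
      using S(2) F by (simp_all add: U_nums)
    show ?thesis
      using FE[OF S(2)] FE[OF U(1)] FE[OF U(2)] F0[OF U(2)] by (simp add: simps)
  qed
  have \<mu>: "F (F (F (E (E \<mu>)))) = 12 *\<^sub>R F \<mu>"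
  proof -
    have U: "E \<mu> \<in> U 2 1" "F \<mu> \<in> U 0 3" "E (F \<mu>) \<in> U 1 2"
      using S(3) E F by (simp_all add: U_nums)
    have 1: "F (E (F \<mu>)) = 3 *\<^sub>R F \<mu>" using FE[OF U(2)] F0[OF U(2)] by (simp add: simps)
    have 2: "F (E (E \<mu>)) = E (E (F \<mu>))" using FE[OF U(1)] FE[OF S(3)] by (simp add: simps)
    have 3: "F (E (E (F \<mu>))) = 4 *\<^sub>R E (F \<mu>)"
      using FE[OF U(3)] scaleR_left_distrib[of 3 1 "E (F \<mu>)"] by (simp add: simps 1)
    show ?thesis by (simp add: 2 3 1 simps)
  qed
  have \<psi>: "F (F (F (E (E (E \<psi>))))) = 36 *\<^sub>R \<psi>"
  proof -
    have U: "E \<psi> \<in> U 1 2" "E (E \<psi>) \<in> U 2 1"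
      using S(4) E by (simp_all add: U_nums)
    have 1: "F (E \<psi>) = 3 *\<^sub>R \<psi>" using FE[OF S(4)] F0[OF S(4)] by (simp add: simps)
    have 2: "F (E (E \<psi>)) = 4 *\<^sub>R E \<psi>"
      using FE[OF U(1)] scaleR_left_distrib[of 3 1 "E \<psi>"] by (simp add: simps 1)
    have 3: "F (E (E (E \<psi>))) = 3 *\<^sub>R E (E \<psi>)"
      using FE[OF U(2)] scaleR_left_diff_distrib[of 4 1 "E (E \<psi>)"] by (simp add: simps 2)
    show ?thesis by (simp add: 3 2 1 simps)
  qed
  show ?thesis by (simp add: simps \<gamma> \<mu> \<psi> algebra_simps)
qed

text \<open>
  The hypotheses are symmetric under exchanging \<open>E\<close> with \<open>F\<close> and the two degrees, which supplies the
  converse direction.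
\<close>

corollary top_zero_iff_bottom_zero:
  fixes E F :: "'a::real_vector \<Rightarrow> 'a" and U :: "nat \<Rightarrow> nat \<Rightarrow> 'a set"
  assumes lin: "linear E" "linear F"
    and E: "\<And>k l u. u \<in> U k (Suc l) \<Longrightarrow> E u \<in> U (Suc k) l"
    and E0: "\<And>k u. u \<in> U k 0 \<Longrightarrow> E u = 0"
    and F: "\<And>k l u. u \<in> U (Suc k) l \<Longrightarrow> F u \<in> U k (Suc l)"
    and F0: "\<And>l u. u \<in> U 0 l \<Longrightarrow> F u = 0"
    and comm: "\<And>k l u. u \<in> U k l \<Longrightarrow> E (F u) - F (E u) = (real k - real l) *\<^sub>R u"
    and S: "\<phi> \<in> U 3 0" "\<gamma> \<in> U 2 1" "\<mu> \<in> U 1 2" "\<psi> \<in> U 0 3"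
  shows "\<phi> - E \<gamma> + (1/2) *\<^sub>R E (E \<mu>) - (1/6) *\<^sub>R E (E (E \<psi>)) = 0 \<longleftrightarrow>
    \<psi> - F \<mu> + (1/2) *\<^sub>R F (F \<gamma>) - (1/6) *\<^sub>R F (F (F \<phi>)) = 0" (is "?P = 0 \<longleftrightarrow> ?Q = 0")
proof
  have "F (F (F ?P)) = (-6) *\<^sub>R ?Q"
    by (rule cube_lowering_top_component[where U = U]) (use assms in auto)
  then show "?Q = 0" if "?P = 0"
    using that by (simp add: linear_0 lin)
  have comm': "F (E u) - E (F u) = (real l - real k) *\<^sub>R u" if "u \<in> U k l" for k l u
    using comm[OF that] by (simp add: algebra_simps)
  have "E (E (E ?Q)) = (-6) *\<^sub>R ?P"
    by (rule cube_lowering_top_component[where U = "\<lambda>k l. U l k"]) (use assms comm' in auto)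
  then show "?P = 0" if "?Q = 0"
    using that by (simp add: linear_0 lin)
qed

section \<open>Anticommutation relations for the odd coordinates\<close>

text \<open>
  Superpolynomials are coefficient functions; with the pointwise operations they form a real
  vector space, so that operators on them can be treated as linear maps.
\<close>

instantiation "fun" :: (type, real_vector) real_vector
begin
definition scaleR_fun_def: "c *\<^sub>R f = (\<lambda>x. c *\<^sub>R f x)"
instance by standard (simp_all add: scaleR_fun_def fun_eq_iff algebra_simps)
end

lemma scaleR_fun_apply [simp]: "(c *\<^sub>R f) x = c *\<^sub>R f x"
  by (simp add: scaleR_fun_def)

lemma sum_fun_apply: "(\<Sum>i\<in>I. f i) x = (\<Sum>i\<in>I. f i x)"
  by (induction I rule: infinite_finite_induct) auto

text \<open>
  The index \<open>Inl a\<close> stands for the coordinate \<open>\<xi>\<^sup>a\<close> and \<open>Inr b\<close> for \<open>\<theta>\<^sub>b\<close>. In a monomial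
  \<open>\<xi>^A \<theta>_B p_K\<close> they appear in the order \<open>precedes\<close>. Joining the two families in one ordered index
  type leaves a single set of anticommutation relations to prove.
\<close>

fun occurs :: "nat + nat \<Rightarrow> smono \<Rightarrow> bool" where
  "occurs (Inl a) (A, B, K) \<longleftrightarrow> a \<in> A"
| "occurs (Inr b) (A, B, K) \<longleftrightarrow> b \<in> B"

fun adjoin :: "nat + nat \<Rightarrow> smono \<Rightarrow> smono" where
  "adjoin (Inl a) (A, B, K) = (insert a A, B, K)"
| "adjoin (Inr b) (A, B, K) = (A, insert b B, K)"

fun remove :: "nat + nat \<Rightarrow> smono \<Rightarrow> smono" where
  "remove (Inl a) (A, B, K) = (A - {a}, B, K)"
| "remove (Inr b) (A, B, K) = (A, B - {b}, K)"

fun precedes :: "nat + nat \<Rightarrow> nat + nat \<Rightarrow> bool" where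
  "precedes (Inl a) (Inl b) \<longleftrightarrow> a < b"
| "precedes (Inr a) (Inr b) \<longleftrightarrow> a < b"
| "precedes (Inl a) (Inr b) \<longleftrightarrow> True"
| "precedes (Inr a) (Inl b) \<longleftrightarrow> False"

text \<open>
  The sign picked up when the generator is moved from the far right of the monomial to its place
  in it.
\<close>

fun passing_sign :: "nat + nat \<Rightarrow> smono \<Rightarrow> real" where
  "passing_sign (Inl a) (A, B, K) = (- 1) ^ (card {i \<in> A. a < i} + card B)"
| "passing_sign (Inr b) (A, B, K) = (- 1) ^ card {i \<in> B. b < i}"

definition right_mult :: "nat + nat \<Rightarrow> spoly \<Rightarrow> spoly" where
  "right_mult x u = (\<lambda>m. if occurs x m then passing_sign x m * u (remove x m) else 0)"

definition right_deriv :: "nat + nat \<Rightarrow> spoly \<Rightarrow> spoly" where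
  "right_deriv x u = (\<lambda>m. if occurs x m then 0 else passing_sign x m * u (adjoin x m))"

lemma rxi_eq_right_deriv: "rxi a = right_deriv (Inl a)"
  and rtheta_eq_right_deriv: "rtheta a = right_deriv (Inr a)"
  by (auto simp: rxi_def rtheta_def right_deriv_def fun_eq_iff)

text \<open>
  In an infinite monomial \<open>card\<close> no longer counts the generators that are passed, and the signs lose
  their meaning. The anticommutation relations concern superpolynomials supported on finite monomials.
\<close>

fun finite_mono :: "smono \<Rightarrow> bool" where
  "finite_mono (A, B, K) \<longleftrightarrow> finite A \<and> finite B"

definition finitary :: "spoly \<Rightarrow> bool" where
  "finitary u \<longleftrightarrow> (\<forall>m. u m \<noteq> 0 \<longrightarrow> finite_mono m)"

lemma mono_simps [simp]:
  "occurs x (adjoin y m) \<longleftrightarrow> x = y \<or> occurs x m"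
  "occurs x (remove y m) \<longleftrightarrow> x \<noteq> y \<and> occurs x m"
  "finite_mono (adjoin x m) \<longleftrightarrow> finite_mono m"
  "finite_mono (remove x m) \<longleftrightarrow> finite_mono m"
  "\<not> occurs x m \<Longrightarrow> remove x (adjoin x m) = m"
  "occurs x m \<Longrightarrow> adjoin x (remove x m) = m"
  "passing_sign x m * passing_sign x m = 1"
  "passing_sign x (adjoin x m) = passing_sign x m"
  "passing_sign x (remove x m) = passing_sign x m"
  by (cases x; cases y; cases m; auto simp: Collect_conv_if simp flip: power_add 
    intro!: arg_cong[where f = "\<lambda>S. (- 1) ^ card S"] arg_cong[where f = "\<lambda>S. (- 1) ^ (card S + _)"])+

lemma adjoin_commute: "adjoin x (adjoin y m) = adjoin y (adjoin x m)"
  by (cases x; cases y; cases m) auto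

lemma remove_commute: "remove x (remove y m) = remove y (remove x m)"
  by (cases x; cases y; cases m) auto

lemma adjoin_remove_commute: "x \<noteq> y \<Longrightarrow> adjoin x (remove y m) = remove y (adjoin x m)"
  by (cases x; cases y; cases m) auto

lemma precedes_total: "x \<noteq> y \<Longrightarrow> precedes x y \<longleftrightarrow> \<not> precedes y x"
  by (cases x; cases y) auto

text \<open>
  Of two different generators exactly one precedes the other, so exactly one of the two passing
  signs is affected by the presence of the other generator. This is why the operators below
  anticommute.
\<close>

lemma passing_sign_adjoin:
  assumes "finite_mono m" "\<not> occurs y m"
  shows "passing_sign x (adjoin y m) = (if precedes x y then - 1 else 1) * passing_sign x m"
proof (cases m)
  case (fields A B K)
  have "{i \<in> insert b S. a < i} = (if a < b then insert b {i \<in> S. a < i} else {i \<in> S. a < i})"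
    for a b and S :: "nat set" by auto
  then show ?thesis using assms fields by (cases x; cases y) auto
qed

lemma passing_sign_remove:
  assumes "finite_mono m" "occurs y m"
  shows "passing_sign x (remove y m) = (if precedes x y then - 1 else 1) * passing_sign x m"
  using passing_sign_adjoin[of "remove y m" y x] assms by (auto split: if_splits)

lemma finitary_outside: "finitary u \<Longrightarrow> \<not> finite_mono m \<Longrightarrow> u m = 0"
  unfolding finitary_def by metis

lemma finitary_ops [simp]:
  "finitary u \<Longrightarrow> finitary (right_mult x u)"
  "finitary u \<Longrightarrow> finitary (right_deriv x u)"
  "finitary u \<Longrightarrow> finitary (dmom i u)"
proof -
  assume u: "finitary u"
  show "finitary (right_mult x u)" "finitary (right_deriv x u)"
    unfolding finitary_def right_mult_def right_deriv_def
    by (metis finitary_outside[OF u] mono_simps(3,4) mult_zero_right)+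
  show "finitary (dmom i u)"
    using u by (auto simp: finitary_def dmom_def)
qed

lemma right_mult_right_mult:
  assumes "finitary u"
  shows "right_mult x (right_mult y u) = - right_mult y (right_mult x u)"
proof
  fix m
  show "right_mult x (right_mult y u) m = (- right_mult y (right_mult x u)) m"
    using finitary_outside[OF assms, of "remove x (remove y m)"] precedes_total[of x y]
    by (cases "x = y"; cases "finite_mono m")
      (auto simp: right_mult_def passing_sign_remove remove_commute[of x y])
qed

lemma right_deriv_right_deriv:
  assumes "finitary u"
  shows "right_deriv x (right_deriv y u) = - right_deriv y (right_deriv x u)"
proof
  fix m
  show "right_deriv x (right_deriv y u) m = (- right_deriv y (right_deriv x u)) m"
    using finitary_outside[OF assms, of "adjoin x (adjoin y m)"] precedes_total[of x y]
    by (cases "x = y"; cases "finite_mono m")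
      (auto simp: right_deriv_def passing_sign_adjoin adjoin_commute[of x y])
qed

lemma right_deriv_right_mult:
  assumes "finitary u"
  shows "right_deriv x (right_mult y u) = (if x = y then u else 0) - right_mult y (right_deriv x u)"
proof
  fix m
  show "right_deriv x (right_mult y u) m = ((if x = y then u else 0) - right_mult y (right_deriv x u)) m"
    using finitary_outside[OF assms, of m] finitary_outside[OF assms, of "remove y (adjoin x m)"] precedes_total[of x y]
    by (cases "x = y"; cases "finite_mono m")
      (auto simp: right_deriv_def right_mult_def passing_sign_adjoin passing_sign_remove adjoin_remove_commute
          simp flip: mult.assoc)
qed

lemma dmom_right_mult: "dmom i (right_mult x u) = right_mult x (dmom i u)"
  by (cases x) (auto simp: dmom_def right_mult_def fun_eq_iff)

lemma dmom_right_deriv: "dmom i (right_deriv x u) = right_deriv x (dmom i u)"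
  by (cases x) (auto simp: dmom_def right_deriv_def fun_eq_iff)

lemma dmom_dmom: "dmom i (dmom j u) = dmom j (dmom i u)"
  by (auto simp: dmom_def fun_eq_iff add_mset_commute)

lemma linear_right_mult: "linear (right_mult x)" and linear_right_deriv: "linear (right_deriv x)" and linear_dmom: "linear (dmom i)"
  by (rule linearI; auto simp: right_mult_def right_deriv_def dmom_def fun_eq_iff algebra_simps)+

lemma finitary_0 [simp]: "finitary 0"
  and finitary_scaleR [simp]: "finitary u \<Longrightarrow> finitary (c *\<^sub>R u)"
  and finitary_diff [simp]: "finitary u \<Longrightarrow> finitary v \<Longrightarrow> finitary (u - v)"
  and finitary_add [simp]: "finitary u \<Longrightarrow> finitary v \<Longrightarrow> finitary (u + v)"
  by (auto simp: finitary_def) (metis add.right_neutral diff_zero)+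

lemma finitary_sum [simp]: "(\<And>i. i \<in> I \<Longrightarrow> finitary (f i)) \<Longrightarrow> finitary (sum f I)"
  by (induction I rule: infinite_finite_induct) auto

section \<open>The bracket with a quadratic function\<close>

text \<open>
  The operator \<open>{\<cdot>, \<omega>}\<close> at a point, for \<open>\<omega> = 1/2 w\<^sub>a\<^sub>b \<eta>\<^sub>a \<eta>\<^sub>b\<close>, where \<open>h\<close> names the odd coordinates \<open>\<eta>\<close> and
  \<open>g\<close> the coordinates conjugate to them. The first sum comes from the odd coordinates; the second
  one from \<open>{p\<^sub>i, \<omega>} = - \<partial>\<^sub>i\<omega>\<close>, with \<open>dw i\<close> the matrix of \<open>\<partial>\<^sub>i\<omega>\<close>. A bivector is the case \<open>g = \<xi>\<close>, \<open>h = \<theta>\<close>, a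
  2-form the case \<open>g = \<theta>\<close>, \<open>h = \<xi>\<close>.
\<close>

definition quad_bracket :: "nat \<Rightarrow> nat \<Rightarrow> (nat \<Rightarrow> nat + nat) \<Rightarrow> (nat \<Rightarrow> nat + nat) \<Rightarrow>
    (nat \<Rightarrow> nat \<Rightarrow> real) \<Rightarrow> (nat \<Rightarrow> nat \<Rightarrow> nat \<Rightarrow> real) \<Rightarrow> spoly \<Rightarrow> spoly" where
  "quad_bracket n r g h w dw u =
     (\<Sum>a<r. \<Sum>b<r. w a b *\<^sub>R right_mult (h b) (right_deriv (g a) u)) -
     (1/2) *\<^sub>R (\<Sum>i<n. \<Sum>b<r. \<Sum>c<r. dw i b c *\<^sub>R right_mult (h c) (right_mult (h b) (dmom i u)))"

lemmas op_linear =
  linear_sum[OF linear_right_mult] linear_sum[OF linear_right_deriv] linear_sum[OF linear_dmom]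
  linear_add[OF linear_right_mult] linear_add[OF linear_right_deriv] linear_add[OF linear_dmom]
  linear_diff[OF linear_right_mult] linear_diff[OF linear_right_deriv] linear_diff[OF linear_dmom]
  linear_neg[OF linear_right_mult] linear_neg[OF linear_right_deriv] linear_neg[OF linear_dmom]
  linear_scale[OF linear_right_mult] linear_scale[OF linear_right_deriv] linear_scale[OF linear_dmom]
  linear_0[OF linear_right_mult] linear_0[OF linear_right_deriv] linear_0[OF linear_dmom]

lemma linear_quad_bracket: "linear (quad_bracket n r g h w dw)"
  by (rule linearI)
    (simp_all add: quad_bracket_def op_linear scaleR_sum_right algebra_simps sum.distrib)

lemma finitary_quad_bracket [simp]: "finitary u \<Longrightarrow> finitary (quad_bracket n r g h w dw u)"
  by (simp add: quad_bracket_def)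

lemma quad_bracket_dmom: "quad_bracket n r g h w dw (dmom i u) = dmom i (quad_bracket n r g h w dw u)"
  by (simp add: quad_bracket_def op_linear dmom_right_mult dmom_right_deriv dmom_dmom[of _ i])

text \<open>
  As \<open>\<omega>\<close> is even, \<open>{\<cdot>, \<omega>}\<close> is a derivation. It kills the coordinates \<open>\<eta>\<close> and sends the conjugate
  ones to linear combinations of the \<open>\<eta>\<close>; the next two lemmas are the Leibniz rule for products with
  one generator.
\<close>

lemma quad_bracket_right_mult_target:
  assumes u: "finitary u" and gh: "\<And>a b. g a \<noteq> h b"
  shows "quad_bracket n r g h w dw (right_mult (h b) u) = right_mult (h b) (quad_bracket n r g h w dw u)"
proof -
  have 1: "right_mult (h c) (right_deriv (g a) (right_mult (h b) u)) = right_mult (h b) (right_mult (h c) (right_deriv (g a) u))" for a c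
    using u gh right_mult_right_mult[of "right_deriv (g a) u" "h c" "h b"] by (simp add: right_deriv_right_mult op_linear)
  have 2: "right_mult (h d) (right_mult (h c) (right_mult (h b) v)) = right_mult (h b) (right_mult (h d) (right_mult (h c) v))"
    if "finitary v" for c d v
    using that right_mult_right_mult[of v "h c" "h b"] right_mult_right_mult[of "right_mult (h c) v" "h d" "h b"] by (simp add: op_linear)
  show ?thesis using u by (simp add: quad_bracket_def 1 2 dmom_right_mult op_linear)
qed

lemma quad_bracket_right_mult_source:
  assumes u: "finitary u" and gh: "\<And>a b. g a \<noteq> h b" and g: "inj g" and a: "a < r"
  shows "quad_bracket n r g h w dw (right_mult (g a) u) =
    right_mult (g a) (quad_bracket n r g h w dw u) + (\<Sum>b<r. w a b *\<^sub>R right_mult (h b) u)"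
proof -
  have 1: "right_mult (h c) (right_deriv (g a') (right_mult (g a) u)) =
      (if a' = a then right_mult (h c) u else 0) + right_mult (g a) (right_mult (h c) (right_deriv (g a') u))" for a' c
    using u injD[OF g] right_mult_right_mult[of "right_deriv (g a') u" "h c" "g a"] by (auto simp: right_deriv_right_mult op_linear)
  have 2: "right_mult (h d) (right_mult (h c) (right_mult (g a) v)) = right_mult (g a) (right_mult (h d) (right_mult (h c) v))"
    if "finitary v" for c d v
    using that right_mult_right_mult[of v "h c" "g a"] right_mult_right_mult[of "right_mult (h c) v" "h d" "g a"] by (simp add: op_linear)
  have 3: "(\<Sum>a'<r. \<Sum>b<r. w a' b *\<^sub>R (if a' = a then right_mult (h b) u else 0)) = (\<Sum>b<r. w a b *\<^sub>R right_mult (h b) u)"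
    using a by (subst sum.swap) (simp add: if_distrib[of "scaleR _"] sum.delta cong: if_cong)
  show ?thesis
    using u by (simp add: quad_bracket_def 1 2 3 dmom_right_mult op_linear scaleR_add_right sum.distrib)
qed

text \<open>
  The commutator of \<open>{\<cdot>, \<omega>}\<close> with the right derivative \<open>\<partial>/\<partial>\<eta>\<^sub>b\<close> is obtained by differentiating the
  coefficients \<open>w\<^sub>a\<^sub>b \<eta>\<^sub>b\<close> and \<open>\<partial>\<^sub>i\<omega>\<close> of this vector field.
\<close>

lemma quad_bracket_right_deriv_target:
  assumes u: "finitary u" and gh: "\<And>a b. g a \<noteq> h b" and h: "inj h" and b: "b < r"
    and skew: "\<And>i b c. dw i b c = - dw i c b"
  shows "quad_bracket n r g h w dw (right_deriv (h b) u) = right_deriv (h b) (quad_bracket n r g h w dw u)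
    - (\<Sum>a<r. w a b *\<^sub>R right_deriv (g a) u) - (\<Sum>i<n. \<Sum>c<r. dw i b c *\<^sub>R right_mult (h c) (dmom i u))"
proof -
  have 1: "right_mult (h c) (right_deriv (g a) (right_deriv (h b) u)) =
      right_deriv (h b) (right_mult (h c) (right_deriv (g a) u)) - (if c = b then right_deriv (g a) u else 0)" for a c
    using u injD[OF h] by (auto simp: right_deriv_right_mult op_linear right_deriv_right_deriv[of u "g a" "h b"])
  have 2: "right_mult (h d) (right_mult (h c) (right_deriv (h b) v)) = right_deriv (h b) (right_mult (h d) (right_mult (h c) v))
      - (if d = b then right_mult (h c) v else 0) + (if c = b then right_mult (h d) v else 0)" if "finitary v" for c d v
    using that injD[OF h] by (auto simp: right_deriv_right_mult op_linear)
  have 3: "(\<Sum>a<r. \<Sum>c<r. w a c *\<^sub>R (if c = b then right_deriv (g a) u else 0)) = (\<Sum>a<r. w a b *\<^sub>R right_deriv (g a) u)"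
    using b by (simp add: if_distrib[of "scaleR _"] sum.delta cong: if_cong)
  have 4: "(\<Sum>c<r. \<Sum>d<r. dw i c d *\<^sub>R (if c = b then right_mult (h d) (dmom i u) else 0)) =
      (\<Sum>d<r. dw i b d *\<^sub>R right_mult (h d) (dmom i u))" for i
    using b by (subst sum.swap) (simp add: if_distrib[of "scaleR _"] sum.delta cong: if_cong)
  have 5: "(\<Sum>c<r. \<Sum>d<r. dw i c d *\<^sub>R (if d = b then right_mult (h c) (dmom i u) else 0)) =
      - (\<Sum>d<r. dw i b d *\<^sub>R right_mult (h d) (dmom i u))" for i
    using b by (simp add: if_distrib[of "scaleR _"] sum.delta cong: if_cong)
      (subst skew, simp add: sum_negf)
  show ?thesis
    using u by (simp add: quad_bracket_def 1 2 3 4 5 dmom_right_deriv op_linear scaleR_add_right scaleR_diff_right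
      sum.distrib sum_subtractf sum_negf) (simp add: algebra_simps fun_eq_iff flip: sum_distrib_left)
qed

lemma sum_rotate: "(\<Sum>a\<in>A. \<Sum>b\<in>B. \<Sum>c\<in>C. f a b c) = (\<Sum>b\<in>B. \<Sum>c\<in>C. \<Sum>a\<in>A. f a b c)"
  by (subst sum.swap, rule sum.cong[OF refl], rule sum.swap)

text \<open>
  The commutator of two vector fields is a vector field. Its part in the directions of \<open>\<xi>\<close> and \<open>\<theta>\<close> is
  linear, with the matrix product \<open>s t = 1\<close> or its transpose as coefficients up to sign, which leaves the
  difference of the two number operators. The coefficients of \<open>\<xi>\<^sup>b \<theta>\<^sub>d \<partial>/\<partial>p\<^sub>i\<close> are, up to transposition
  and sign, the entries of \<open>(\<partial>\<^sub>i s) t + s (\<partial>\<^sub>i t)\<close> and vanish.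
\<close>

lemma quad_bracket_commutator:
  fixes n r :: nat and s t :: "nat \<Rightarrow> nat \<Rightarrow> real" and ds dt :: "nat \<Rightarrow> nat \<Rightarrow> nat \<Rightarrow> real"
  defines "E \<equiv> quad_bracket n r Inl Inr s ds" and "F \<equiv> quad_bracket n r Inr Inl t dt"
  assumes u: "finitary u"
    and skew: "\<And>a b. s a b = - s b a" "\<And>a b. t a b = - t b a"
      "\<And>i a b. ds i a b = - ds i b a" "\<And>i a b. dt i a b = - dt i b a"
    and inv: "\<And>a c. a < r \<Longrightarrow> c < r \<Longrightarrow> (\<Sum>b<r. s a b * t b c) = (if a = c then 1 else 0)"
    and dinv: "\<And>i a c. i < n \<Longrightarrow> a < r \<Longrightarrow> c < r \<Longrightarrow> (\<Sum>b<r. ds i a b * t b c + s a b * dt i b c) = 0"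
  shows "E (F u) - F (E u) =
    (\<Sum>a<r. right_mult (Inr a) (right_deriv (Inr a) u)) - (\<Sum>a<r. right_mult (Inl a) (right_deriv (Inl a) u))"
proof -
  let ?\<xi> = "\<lambda>a. right_mult (Inl a)" and ?\<theta> = "\<lambda>a. right_mult (Inr a)"
  let ?d\<xi> = "\<lambda>a. right_deriv (Inl a)" and ?d\<theta> = "\<lambda>a. right_deriv (Inr a)"
  \<comment> \<open>The terms of \<open>F u\<close>, with \<open>E\<close> moved to the right by the Leibniz rule.\<close>
  have 1: "E (?\<xi> b (?d\<theta> a u)) = ?\<xi> b (?d\<theta> a (E u))
      - (\<Sum>c<r. s c a *\<^sub>R ?\<xi> b (?d\<xi> c u)) - (\<Sum>i<n. \<Sum>c<r. ds i a c *\<^sub>R ?\<xi> b (?\<theta> c (dmom i u)))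
      + (\<Sum>c<r. s b c *\<^sub>R ?\<theta> c (?d\<theta> a u))" if "a < r" "b < r" for a b
    using u that quad_bracket_right_deriv_target[where g = Inl and h = Inr and w = s, OF u _ _ _ skew(3), of a] unfolding E_def
    by (simp add: quad_bracket_right_mult_source op_linear)
  have 2: "E (?\<xi> c (?\<xi> b (dmom i u))) = ?\<xi> c (?\<xi> b (dmom i (E u)))
      - (\<Sum>d<r. s c d *\<^sub>R ?\<xi> b (?\<theta> d (dmom i u))) + (\<Sum>d<r. s b d *\<^sub>R ?\<xi> c (?\<theta> d (dmom i u)))"
    if "b < r" "c < r" for i b c
    using u that unfolding E_def
    by (simp add: quad_bracket_right_mult_source quad_bracket_dmom op_linear right_mult_right_mult[of _ "Inr _" "Inl b"] sum_negf)
  have "E (F u) = F (E u) 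
     - (\<Sum>a<r. \<Sum>b<r. \<Sum>c<r. (t a b * s c a) *\<^sub>R ?\<xi> b (?d\<xi> c u))
     - (\<Sum>a<r. \<Sum>b<r. \<Sum>i<n. \<Sum>c<r. (t a b * ds i a c) *\<^sub>R ?\<xi> b (?\<theta> c (dmom i u)))
     + (\<Sum>a<r. \<Sum>b<r. \<Sum>c<r. (t a b * s b c) *\<^sub>R ?\<theta> c (?d\<theta> a u))
     - (1/2) *\<^sub>R ((\<Sum>i<n. \<Sum>b<r. \<Sum>c<r. \<Sum>d<r. (dt i b c * s b d) *\<^sub>R ?\<xi> c (?\<theta> d (dmom i u)))
      - (\<Sum>i<n. \<Sum>b<r. \<Sum>c<r. \<Sum>d<r. (dt i b c * s c d) *\<^sub>R ?\<xi> b (?\<theta> d (dmom i u))))"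
  proof -
    have "E (F u) = (\<Sum>a<r. \<Sum>b<r. t a b *\<^sub>R E (?\<xi> b (?d\<theta> a u)))
        - (1/2) *\<^sub>R (\<Sum>i<n. \<Sum>b<r. \<Sum>c<r. dt i b c *\<^sub>R E (?\<xi> c (?\<xi> b (dmom i u))))"
      unfolding F_def quad_bracket_def[of n r Inr Inl] E_def
      by (simp add: linear_diff[OF linear_quad_bracket] linear_sum[OF linear_quad_bracket] linear_scale[OF linear_quad_bracket])
    then show ?thesis
      unfolding F_def quad_bracket_def[of n r Inr Inl]
      by (simp add: 1 2 scaleR_add_right scaleR_diff_right sum.distrib sum_subtractf scaleR_sum_right)
  qed
  moreover have "(\<Sum>a<r. \<Sum>b<r. \<Sum>c<r. (t a b * s c a) *\<^sub>R ?\<xi> b (?d\<xi> c u)) = (\<Sum>a<r. ?\<xi> a (?d\<xi> a u))"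
  proof -
    have "(\<Sum>a<r. \<Sum>b<r. \<Sum>c<r. (t a b * s c a) *\<^sub>R ?\<xi> b (?d\<xi> c u)) =
        (\<Sum>b<r. \<Sum>c<r. \<Sum>a<r. (s c a * t a b) *\<^sub>R ?\<xi> b (?d\<xi> c u))"
      by (subst sum_rotate) (simp add: mult.commute)
    also have "\<dots> = (\<Sum>b<r. \<Sum>c<r. (if c = b then 1 else 0) *\<^sub>R ?\<xi> b (?d\<xi> c u))"
      by (simp add: inv flip: scaleR_sum_left)
    finally show ?thesis by (simp add: if_distrib[of "\<lambda>c. c *\<^sub>R _"] cong: if_cong)
  qed
  moreover have "(\<Sum>a<r. \<Sum>b<r. \<Sum>c<r. (t a b * s b c) *\<^sub>R ?\<theta> c (?d\<theta> a u)) = (\<Sum>a<r. ?\<theta> a (?d\<theta> a u))"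
  proof -
    have ts: "t a b * s b c = s c b * t b a" for a b c
      using skew(1)[of b c] skew(2)[of a b] by simp
    have "(\<Sum>a<r. \<Sum>b<r. \<Sum>c<r. (t a b * s b c) *\<^sub>R ?\<theta> c (?d\<theta> a u)) =
        (\<Sum>a<r. \<Sum>c<r. \<Sum>b<r. (s c b * t b a) *\<^sub>R ?\<theta> c (?d\<theta> a u))"
      unfolding ts by (rule sum.cong[OF refl], rule sum.swap)
    also have "\<dots> = (\<Sum>a<r. \<Sum>c<r. (if c = a then 1 else 0) *\<^sub>R ?\<theta> c (?d\<theta> a u))"
      by (simp add: inv flip: scaleR_sum_left)
    finally show ?thesis by (simp add: if_distrib[of "\<lambda>c. c *\<^sub>R _"] cong: if_cong)
  qed
  moreover
  \<comment> \<open>The momentum terms: each of the three sums is \<open>\<plusminus> ?X\<close>, and they add up to 0.\<close>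
  let ?X = "\<Sum>i<n. \<Sum>b<r. \<Sum>d<r. (\<Sum>c<r. s d c * dt i c b) *\<^sub>R ?\<xi> b (?\<theta> d (dmom i u))"
  have "(\<Sum>a<r. \<Sum>b<r. \<Sum>i<n. \<Sum>c<r. (t a b * ds i a c) *\<^sub>R ?\<xi> b (?\<theta> c (dmom i u))) = ?X"
  proof -
    have "(\<Sum>a<r. t a b * ds i a d) = (\<Sum>c<r. s d c * dt i c b)"
      if "i < n" "b < r" "d < r" for i b d
    proof -
      have "t a b * ds i a d = - (ds i d a * t a b)" for a
        using skew(3)[of i a d] by simp
      then show ?thesis
        using dinv[OF that(1,3,2)] by (simp add: sum.distrib sum_negf)
    qed
    then have "?X = (\<Sum>i<n. \<Sum>b<r. \<Sum>d<r. \<Sum>a<r. (t a b * ds i a d) *\<^sub>R ?\<xi> b (?\<theta> d (dmom i u)))"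
      by (simp flip: scaleR_sum_left)
    also have "\<dots> = (\<Sum>i<n. \<Sum>b<r. \<Sum>a<r. \<Sum>d<r. (t a b * ds i a d) *\<^sub>R ?\<xi> b (?\<theta> d (dmom i u)))"
      by (rule sum.cong[OF refl], rule sum.cong[OF refl], rule sum.swap)
    also have "\<dots> = (\<Sum>b<r. \<Sum>a<r. \<Sum>i<n. \<Sum>d<r. (t a b * ds i a d) *\<^sub>R ?\<xi> b (?\<theta> d (dmom i u)))"
      by (rule sum_rotate)
    also have "\<dots> = (\<Sum>a<r. \<Sum>b<r. \<Sum>i<n. \<Sum>d<r. (t a b * ds i a d) *\<^sub>R ?\<xi> b (?\<theta> d (dmom i u)))"
      by (rule sum.swap)
    finally show ?thesis by (rule sym)
  qed
  moreover have "(\<Sum>i<n. \<Sum>b<r. \<Sum>c<r. \<Sum>d<r. (dt i b c * s b d) *\<^sub>R ?\<xi> c (?\<theta> d (dmom i u))) = - ?X"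
  proof -
    have "dt i b c * s b d = - (s d b * dt i b c)" for i b c d
      using skew(1)[of b d] by simp
    then have "(\<Sum>i<n. \<Sum>b<r. \<Sum>c<r. \<Sum>d<r. (dt i b c * s b d) *\<^sub>R ?\<xi> c (?\<theta> d (dmom i u)))
      = - (\<Sum>i<n. \<Sum>b<r. \<Sum>c<r. \<Sum>d<r. (s d b * dt i b c) *\<^sub>R ?\<xi> c (?\<theta> d (dmom i u)))"
      by (simp add: sum_negf)
    also have "(\<Sum>i<n. \<Sum>b<r. \<Sum>c<r. \<Sum>d<r. (s d b * dt i b c) *\<^sub>R ?\<xi> c (?\<theta> d (dmom i u))) = ?X"
      unfolding scaleR_sum_left
      by (rule sum.cong[OF refl], rule sum_rotate)
    finally show ?thesis .
  qed
  moreover have "(\<Sum>i<n. \<Sum>b<r. \<Sum>c<r. \<Sum>d<r. (dt i b c * s c d) *\<^sub>R ?\<xi> b (?\<theta> d (dmom i u))) = ?X"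
  proof -
    have ts: "dt i b c * s c d = s d c * dt i c b" for i b c d
      using skew(1)[of d c] skew(4)[of i b c] by simp
    show ?thesis
      unfolding ts scaleR_sum_left
      by (rule sum.cong[OF refl], rule sum.cong[OF refl], rule sum.swap)
  qed
  ultimately show ?thesis
    by (simp add: fun_eq_iff)
qed

section \<open>Bidegrees\<close>

definition homog :: "nat \<Rightarrow> nat \<Rightarrow> nat \<Rightarrow> nat \<Rightarrow> spoly set" where
  "homog n r k l = {u. \<forall>m. u m \<noteq> 0 \<longrightarrow> valid_mono n r m \<and> bidegree m = (k, l)}"

lemma homogI:
  assumes "\<And>A B K. u (A, B, K) \<noteq> 0 \<Longrightarrow> A \<subseteq> {..<r} \<and> B \<subseteq> {..<r} \<and> set_mset K \<subseteq> {..<n} \<and>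
    card B + size K = k \<and> card A + size K = l"
  shows "u \<in> homog n r k l"
  using assms by (auto simp: homog_def valid_mono_def bidegree_def)

lemma homogD:
  assumes "u \<in> homog n r k l" "u (A, B, K) \<noteq> 0"
  shows "A \<subseteq> {..<r}" "B \<subseteq> {..<r}" "set_mset K \<subseteq> {..<n}" "card B + size K = k" "card A + size K = l"
    "finite A" "finite B"
proof -
  show *: "A \<subseteq> {..<r}" "B \<subseteq> {..<r}" "set_mset K \<subseteq> {..<n}" "card B + size K = k" "card A + size K = l"
    using assms by (auto simp: homog_def valid_mono_def bidegree_def)
  show "finite A" "finite B"
    using *(1,2) finite_subset by blast+
qed

lemma homog_finitary: "u \<in> homog n r k l \<Longrightarrow> finitary u"
  unfolding finitary_def using homogD(6,7) by (metis finite_mono.simps prod_cases3)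

lemma homog_0 [simp]: "0 \<in> homog n r k l"
  and homog_scaleR: "u \<in> homog n r k l \<Longrightarrow> c *\<^sub>R u \<in> homog n r k l"
  by (auto simp: homog_def)

lemma homog_add: "u \<in> homog n r k l \<Longrightarrow> v \<in> homog n r k l \<Longrightarrow> u + v \<in> homog n r k l"
  and homog_diff: "u \<in> homog n r k l \<Longrightarrow> v \<in> homog n r k l \<Longrightarrow> u - v \<in> homog n r k l"
  unfolding homog_def by (simp, metis add.right_neutral diff_zero)+

lemma homog_sum: "(\<And>i. i \<in> I \<Longrightarrow> f i \<in> homog n r k l) \<Longrightarrow> sum f I \<in> homog n r k l"
  by (induction I rule: infinite_finite_induct) (auto intro: homog_add)

lemma homog_right_mult_xi:
  assumes u: "u \<in> homog n r k l" and a: "a < r"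
  shows "right_mult (Inl a) u \<in> homog n r k (Suc l)"
proof (rule homogI)
  fix A B K assume "right_mult (Inl a) u (A, B, K) \<noteq> 0"
  then have "a \<in> A" "u (A - {a}, B, K) \<noteq> 0" by (auto simp: right_mult_def split: if_splits)
  with homogD[OF u this(2)] a card_gt_0_iff[of A] show "A \<subseteq> {..<r} \<and> B \<subseteq> {..<r} \<and> set_mset K \<subseteq> {..<n} \<and>
      card B + size K = k \<and> card A + size K = Suc l"
    by auto
qed

lemma homog_right_mult_theta:
  assumes u: "u \<in> homog n r k l" and a: "a < r"
  shows "right_mult (Inr a) u \<in> homog n r (Suc k) l"
proof (rule homogI)
  fix A B K assume "right_mult (Inr a) u (A, B, K) \<noteq> 0"
  then have "a \<in> B" "u (A, B - {a}, K) \<noteq> 0" by (auto simp: right_mult_def split: if_splits)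
  with homogD[OF u this(2)] a card_gt_0_iff[of B] show "A \<subseteq> {..<r} \<and> B \<subseteq> {..<r} \<and> set_mset K \<subseteq> {..<n} \<and>
      card B + size K = Suc k \<and> card A + size K = l"
    by auto
qed

lemma homog_right_deriv_xi: "right_deriv (Inl a) u \<in> homog n r k l" if u: "u \<in> homog n r k (Suc l)"
proof (rule homogI)
  fix A B K assume "right_deriv (Inl a) u (A, B, K) \<noteq> 0"
  then have "a \<notin> A" "u (insert a A, B, K) \<noteq> 0" by (auto simp: right_deriv_def split: if_splits)
  with homogD[OF u this(2)] show "A \<subseteq> {..<r} \<and> B \<subseteq> {..<r} \<and> set_mset K \<subseteq> {..<n} \<and>
      card B + size K = k \<and> card A + size K = l" by auto
qed

lemma homog_right_deriv_theta: "right_deriv (Inr a) u \<in> homog n r k l" if u: "u \<in> homog n r (Suc k) l"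
proof (rule homogI)
  fix A B K assume "right_deriv (Inr a) u (A, B, K) \<noteq> 0"
  then have "a \<notin> B" "u (A, insert a B, K) \<noteq> 0" by (auto simp: right_deriv_def split: if_splits)
  with homogD[OF u this(2)] show "A \<subseteq> {..<r} \<and> B \<subseteq> {..<r} \<and> set_mset K \<subseteq> {..<n} \<and>
      card B + size K = k \<and> card A + size K = l" by auto
qed

lemma homog_dmom: "dmom i u \<in> homog n r k l" if u: "u \<in> homog n r (Suc k) (Suc l)"
proof (rule homogI)
  fix A B K assume "dmom i u (A, B, K) \<noteq> 0"
  then have "u (A, B, add_mset i K) \<noteq> 0" by (auto simp: dmom_def)
  with homogD[OF u this] show "A \<subseteq> {..<r} \<and> B \<subseteq> {..<r} \<and> set_mset K \<subseteq> {..<n} \<and>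
      card B + size K = k \<and> card A + size K = l" by auto
qed

lemma right_deriv_xi_eq_0: "right_deriv (Inl a) u = 0" if u: "u \<in> homog n r k 0"
proof
  fix m show "right_deriv (Inl a) u m = 0 m"
    using homogD(5,6)[OF u, of "insert a (fst m)" "fst (snd m)" "snd (snd m)"]
    by (cases m) (auto simp: right_deriv_def)
qed

lemma right_deriv_theta_eq_0: "right_deriv (Inr a) u = 0" if u: "u \<in> homog n r 0 l"
proof
  fix m show "right_deriv (Inr a) u m = 0 m"
    using homogD(4,7)[OF u, of "fst m" "insert a (fst (snd m))" "snd (snd m)"]
    by (cases m) (auto simp: right_deriv_def)
qed

lemma dmom_eq_0: "dmom i u = 0" if u: "u \<in> homog n r k l" and "k = 0 \<or> l = 0"
proof
  fix m show "dmom i u m = 0 m"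
    using that(2) homogD(4,5)[OF u, of "fst m" "fst (snd m)" "add_mset i (snd (snd m))"]
    by (cases m) (auto simp: dmom_def)
qed

text \<open>
  Replacing a \<open>\<xi>\<close> by a \<open>\<theta>\<close>, or a momentum of bidegree \<open>(1, 1)\<close> by two \<open>\<theta>\<close>'s, raises the first degree
  by one and lowers the second one by one.
\<close>

lemma quad_bracket_xi_theta_homog:
  assumes u: "u \<in> homog n r k (Suc l)"
  shows "quad_bracket n r Inl Inr w dw u \<in> homog n r (Suc k) l"
proof -
  \<comment> \<open>For \<open>k = 0\<close> there is no momentum to differentiate and the term is 0.\<close>
  have "right_mult (Inr c) (right_mult (Inr b) (dmom i u)) \<in> homog n r (Suc k) l" if "b < r" "c < r" for i b c
    using u that by (cases k) (auto simp: op_linear dmom_eq_0[OF u] intro!: homog_right_mult_theta homog_dmom)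
  then show ?thesis
    unfolding quad_bracket_def
    by (intro homog_diff homog_sum homog_scaleR homog_right_mult_theta[OF homog_right_deriv_xi[OF u]]) auto
qed

lemma quad_bracket_theta_xi_homog:
  assumes u: "u \<in> homog n r (Suc k) l"
  shows "quad_bracket n r Inr Inl w dw u \<in> homog n r k (Suc l)"
proof -
  have "right_mult (Inl c) (right_mult (Inl b) (dmom i u)) \<in> homog n r k (Suc l)" if "b < r" "c < r" for i b c
    using u that by (cases l) (auto simp: op_linear dmom_eq_0[OF u] intro!: homog_right_mult_xi homog_dmom)
  then show ?thesis
    unfolding quad_bracket_def
    by (intro homog_diff homog_sum homog_scaleR homog_right_mult_xi[OF homog_right_deriv_theta[OF u]]) auto
qed

lemma quad_bracket_xi_theta_eq_0: "u \<in> homog n r k 0 \<Longrightarrow> quad_bracket n r Inl Inr w dw u = 0"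
  and quad_bracket_theta_xi_eq_0: "u \<in> homog n r 0 l \<Longrightarrow> quad_bracket n r Inr Inl w dw u = 0"
  by (simp_all add: quad_bracket_def right_deriv_xi_eq_0 right_deriv_theta_eq_0 dmom_eq_0 op_linear)

text \<open>
  The two sums count the \<open>\<theta>\<close>'s and the \<open>\<xi>\<close>'s in a monomial. Momenta enter both degrees equally, so the
  difference of the counts is the difference of the degrees.
\<close>

lemma number_operators:
  assumes u: "u \<in> homog n r k l"
  shows "(\<Sum>a<r. right_mult (Inr a) (right_deriv (Inr a) u)) - (\<Sum>a<r. right_mult (Inl a) (right_deriv (Inl a) u)) =
    (real k - real l) *\<^sub>R u"
proof
  fix m :: smono
  obtain A B K where m: "m = (A, B, K)" by (cases m)
  have 1: "right_mult x (right_deriv x u) m = (if occurs x m then u m else 0)" for x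
    by (simp add: right_mult_def right_deriv_def mult.assoc[symmetric])
  have 2: "(\<Sum>a<r. if a \<in> S then u m else 0) = real (card S) * u m" if "S \<subseteq> {..<r}" for S
    using that by (simp add: sum.If_cases Int_absorb1)
  show "((\<Sum>a<r. right_mult (Inr a) (right_deriv (Inr a) u)) - (\<Sum>a<r. right_mult (Inl a) (right_deriv (Inl a) u))) m =
      ((real k - real l) *\<^sub>R u) m"
  proof (cases "u m = 0")
    case False
    then have "A \<subseteq> {..<r}" "B \<subseteq> {..<r}" "k = card B + size K" "l = card A + size K"
      using u by (auto simp: homog_def m valid_mono_def bidegree_def)
    then show ?thesis
      using 2[of A] 2[of B] by (simp add: sum_fun_apply 1) (simp add: m algebra_simps)
  qed (simp add: sum_fun_apply 1 cong: if_cong)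
qed

section \<open>The big bracket with bivectors and 2-forms\<close>

lemma finite_submultisets: "finite {K'. K' \<subseteq># K}"
proof (rule finite_subset)
  show "{K'. K' \<subseteq># K} \<subseteq> (\<Union>k\<le>size K. multisets_of_size (set_mset K) k)"
    by (auto simp: multisets_of_size_def dest: set_mset_mono size_mset_mono)
qed (auto intro: finite_multisets_of_size)

text \<open>
  A factor without momenta can be split off in one way only, so the sum over all splittings of the monomial
  collapses to a single term.
\<close>

lemma smult_smonom:
  "smult w (smonom (A0, B0, {#})) (A, B, K) =
    (if finite A \<and> finite B \<and> A0 \<subseteq> A \<and> B0 \<subseteq> B
     then smono_sign (A - A0) (B - B0) A0 B0 * w (A - A0, B - B0, K) else 0)"
proof (cases "finite A \<and> finite B")
  case True
  have "smult w (smonom (A0, B0, {#})) (A, B, K) =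
      (\<Sum>(A', B', K') \<in> Pow A \<times> Pow B \<times> {K'. K' \<subseteq># K}.
        smono_sign A' B' (A - A') (B - B') * w (A', B', K') * smonom (A0, B0, {#}) (A - A', B - B', K - K'))"
    by (simp add: smult_def sum.cartesian_product)
  also have "\<dots> = (\<Sum>(A', B', K') \<in> (if A0 \<subseteq> A \<and> B0 \<subseteq> B then {(A - A0, B - B0, K)} else {}).
        smono_sign A' B' (A - A') (B - B') * w (A', B', K') * smonom (A0, B0, {#}) (A - A', B - B', K - K'))"
  proof (rule sum.mono_neutral_right)
    show "finite (Pow A \<times> Pow B \<times> {K'. K' \<subseteq># K})"
      using True by (simp add: finite_submultisets)
    have "K' = K" if "K - K' = {#}" "K' \<subseteq># K" for K' :: "nat multiset"
      using that by (simp add: Diff_eq_empty_iff_mset subset_mset.antisym)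
    then show "\<forall>x\<in>Pow A \<times> Pow B \<times> {K'. K' \<subseteq># K} - (if A0 \<subseteq> A \<and> B0 \<subseteq> B then {(A - A0, B - B0, K)} else {}).
      (case x of (A', B', K') \<Rightarrow> smono_sign A' B' (A - A') (B - B') * w (A', B', K') *
        smonom (A0, B0, {#}) (A - A', B - B', K - K')) = 0"
      by (auto simp: smonom_def double_diff split: if_splits)
  qed auto
  also have "\<dots> = (if A0 \<subseteq> A \<and> B0 \<subseteq> B
     then smono_sign (A - A0) (B - B0) A0 B0 * w (A - A0, B - B0, K) else 0)"
    by (simp add: smonom_def double_diff)
  finally show ?thesis using True by simp
qed (auto simp: smult_def)

lemma linear_smult: "linear (smult w)"
  by (rule linearI)
    (auto simp: smult_def fun_eq_iff sum_distrib_left algebra_simps sum.distrib)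

lemma smult_sxi: "smult w (sxi a) = right_mult (Inl a) w" if "finitary w"
proof
  fix m :: smono
  obtain A B K where m: "m = (A, B, K)" by (cases m)
  have "{(i, j). i \<in> A - {a} \<and> j \<in> {a} \<and> j < i} = (\<lambda>i. (i, a)) ` {i \<in> A. a < i}" by auto
  then have "inversions (A - {a}) {a} = card {i \<in> A. a < i}"
    by (simp add: inversions_def card_image inj_on_def)
  then show "smult w (sxi a) m = right_mult (Inl a) w m"
    using finitary_outside[OF that, of "(A - {a}, B, K)"]
    by (auto simp: m smult_smonom right_mult_def smono_sign_def inversions_def[of B] add.commute)
qed

lemma smult_stheta: "smult w (stheta b) = right_mult (Inr b) w" if "finitary w"
proof
  fix m :: smono
  obtain A B K where m: "m = (A, B, K)" by (cases m)
  have "{(i, j). i \<in> B - {b} \<and> j \<in> {b} \<and> j < i} = (\<lambda>i. (i, b)) ` {i \<in> B. b < i}" by auto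
  then have "inversions (B - {b}) {b} = card {i \<in> B. b < i}"
    by (simp add: inversions_def card_image inj_on_def)
  then show "smult w (stheta b) m = right_mult (Inr b) w m"
    using finitary_outside[OF that, of "(A, B - {b}, K)"]
    by (auto simp: m smult_smonom right_mult_def smono_sign_def inversions_def[of A])
qed

lemma inversions_pair:
  assumes "finite B" "a < b" "b \<in> B"
  shows "inversions (B - {a, b}) {a, b} = card {i \<in> B. b < i} + card {i \<in> B - {b}. a < i}"
proof -
  have "{(i, j). i \<in> B - {a, b} \<and> j \<in> {a, b} \<and> j < i} =
      (\<lambda>i. (i, b)) ` {i \<in> B. b < i} \<union> (\<lambda>i. (i, a)) ` {i \<in> B - {b}. a < i}"
    using assms by auto
  then show ?thesis
    using assms by (simp add: inversions_def) (subst card_Un_disjoint; auto simp: card_image inj_on_def)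
qed

lemma smult_sxi_sxi:
  assumes "finitary w" "a < b"
  shows "smult w (smonom ({a, b}, {}, {#})) = right_mult (Inl b) (right_mult (Inl a) w)"
proof
  fix m :: smono
  obtain A B K where m: "m = (A, B, K)" by (cases m)
  have "A - {b} - {a} = A - {a, b}" by auto
  moreover have "(- 1) ^ (k + k + (i + j)) = ((- 1) ^ (i + k) * (- 1) ^ (j + k) :: real)" for i j k :: nat
    by (simp add: power_add)
  ultimately show "smult w (smonom ({a, b}, {}, {#})) m = right_mult (Inl b) (right_mult (Inl a) w) m"
    using finitary_outside[OF assms(1), of "(A - {a, b}, B, K)"] inversions_pair[of A a b] assms(2)
    by (auto simp: m smult_smonom right_mult_def smono_sign_def inversions_def[of B])
qed

lemma smult_stheta_stheta:
  assumes "finitary w" "a < b"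
  shows "smult w (smonom ({}, {a, b}, {#})) = right_mult (Inr b) (right_mult (Inr a) w)"
proof
  fix m :: smono
  obtain A B K where m: "m = (A, B, K)" by (cases m)
  have "B - {b} - {a} = B - {a, b}" by auto
  then show "smult w (smonom ({}, {a, b}, {#})) m = right_mult (Inr b) (right_mult (Inr a) w) m"
    using finitary_outside[OF assms(1), of "(A, B - {a, b}, K)"] inversions_pair[of B a b] assms(2)
    by (auto simp: m smult_smonom right_mult_def smono_sign_def inversions_def[of A] simp flip: power_add mult.assoc)
qed

text \<open>
  The skew-symmetric matrix of a quadratic function whose coefficient at the generators \<open>a < b\<close> is
  \<open>f {a, b}\<close>.
\<close>

definition skew_coeff :: "(nat set \<Rightarrow> real) \<Rightarrow> nat \<Rightarrow> nat \<Rightarrow> real" where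
  "skew_coeff f a b = (if a < b then f {a, b} else if b < a then - f {a, b} else 0)"

lemma skew_coeff_swap: "skew_coeff f a b = - skew_coeff f b a"
  by (auto simp: skew_coeff_def insert_commute)

text \<open>
  The ordered monomials give sums over \<open>a < b\<close>; half of the sum over all pairs is the matrix form of the
  same expression.
\<close>

lemma sum_skew_coeff:
  fixes X :: "nat \<Rightarrow> nat \<Rightarrow> 'a::real_vector"
  assumes "\<And>a b. X a b = - X b a"
  shows "(\<Sum>a<r. \<Sum>b<r. (if a < b then f {a, b} else 0) *\<^sub>R X a b) =
    (1/2) *\<^sub>R (\<Sum>a<r. \<Sum>b<r. skew_coeff f a b *\<^sub>R X a b)"
proof -
  let ?T = "\<Sum>a<r. \<Sum>b<r. (if a < b then f {a, b} else 0) *\<^sub>R X a b"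
  have "skew_coeff f a b *\<^sub>R X a b = (if a < b then f {a, b} else 0) *\<^sub>R X a b +
      (if b < a then f {b, a} else 0) *\<^sub>R X b a" for a b
    using assms[of a b] by (auto simp: skew_coeff_def insert_commute)
  then have "(\<Sum>a<r. \<Sum>b<r. skew_coeff f a b *\<^sub>R X a b) =
      ?T + (\<Sum>a<r. \<Sum>b<r. (if b < a then f {b, a} else 0) *\<^sub>R X b a)"
    by (simp add: sum.distrib)
  also have "(\<Sum>a<r. \<Sum>b<r. (if b < a then f {b, a} else 0) *\<^sub>R X b a) = ?T"
    by (rule sum.swap)
  finally show ?thesis by (simp flip: scaleR_2)
qed

lemma card_2_less: "card B = 2 \<Longrightarrow> \<exists>a b. a < b \<and> B = {a, b}" for B :: "nat set"
  by (metis card_2_iff insert_commute nat_neq_iff)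

lemma doubleton_less_eq: "a < b \<Longrightarrow> c < d \<Longrightarrow> {a, b} = {c, d} \<longleftrightarrow> a = c \<and> b = d" for a b c d :: nat
  by (auto simp: doubleton_eq_iff)

lemma bivector_expansion:
  assumes v: "v \<in> homog n r 2 0"
  shows "v = (\<Sum>a<r. \<Sum>b<r. (if a < b then v ({}, {a, b}, {#}) else 0) *\<^sub>R smonom ({}, {a, b}, {#}))"
    (is "v = ?w")
proof
  fix m :: smono
  obtain A B K where m: "m = (A, B, K)" by (cases m)
  have w: "?w m = (\<Sum>a<r. \<Sum>b<r. if a < b \<and> m = ({}, {a, b}, {#}) then v m else 0)"
    unfolding sum_fun_apply by (intro sum.cong refl) (simp add: smonom_def)
  show "v m = ?w m"
  proof (cases "v m = 0")
    case True
    then show ?thesis unfolding w True by simp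
  next
    case False
    then have "A = {}" "K = {#}" "card B = 2" "B \<subseteq> {..<r}"
      using homogD[OF v, of A B K] by (auto simp: m)
    moreover then obtain a b where "a < b" "B = {a, b}" using card_2_less by blast
    ultimately have ab: "m = ({}, {a, b}, {#})" "a < b" "a < r" "b < r" using m by auto
    have "c < d \<and> m = ({}, {c, d}, {#}) \<longleftrightarrow> c = a \<and> d = b" for c d
      by (metis ab(1,2) doubleton_less_eq Pair_inject)
    then have "?w m = (\<Sum>c<r. \<Sum>d<r. if c = a \<and> d = b then v m else 0)"
      unfolding w by (simp only:)
    also have "\<dots> = (\<Sum>c<r. if c = a then v m else 0)"
      using ab(4) by (intro sum.cong refl) auto
    finally show ?thesis using ab(3) by simp
  qed
qed

lemma form_expansion:
  assumes v: "v \<in> homog n r 0 2"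
  shows "v = (\<Sum>a<r. \<Sum>b<r. (if a < b then v ({a, b}, {}, {#}) else 0) *\<^sub>R smonom ({a, b}, {}, {#}))"
    (is "v = ?w")
proof
  fix m :: smono
  obtain A B K where m: "m = (A, B, K)" by (cases m)
  have w: "?w m = (\<Sum>a<r. \<Sum>b<r. if a < b \<and> m = ({a, b}, {}, {#}) then v m else 0)"
    unfolding sum_fun_apply by (intro sum.cong refl) (simp add: smonom_def)
  show "v m = ?w m"
  proof (cases "v m = 0")
    case True
    then show ?thesis unfolding w True by simp
  next
    case False
    then have "B = {}" "K = {#}" "card A = 2" "A \<subseteq> {..<r}"
      using homogD[OF v, of A B K] by (auto simp: m)
    moreover then obtain a b where "a < b" "A = {a, b}" using card_2_less by blast
    ultimately have ab: "m = ({a, b}, {}, {#})" "a < b" "a < r" "b < r" using m by auto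
    have "c < d \<and> m = ({c, d}, {}, {#}) \<longleftrightarrow> c = a \<and> d = b" for c d
      by (metis ab(1,2) doubleton_less_eq Pair_inject)
    then have "?w m = (\<Sum>c<r. \<Sum>d<r. if c = a \<and> d = b then v m else 0)"
      unfolding w by (simp only:)
    also have "\<dots> = (\<Sum>c<r. if c = a then v m else 0)"
      using ab(4) by (intro sum.cong refl) auto
    finally show ?thesis using ab(3) by simp
  qed
qed

lemma smult_bivector:
  assumes "finitary w" "v \<in> homog n r 2 0"
  shows "smult w v = (1/2) *\<^sub>R
    (\<Sum>a<r. \<Sum>b<r. skew_coeff (\<lambda>B. v ({}, B, {#})) a b *\<^sub>R right_mult (Inr b) (right_mult (Inr a) w))"
proof -
  have eq: "(if a < b then v ({}, {a, b}, {#}) else 0) *\<^sub>R smult w (smonom ({}, {a, b}, {#})) =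
      (if a < b then v ({}, {a, b}, {#}) else 0) *\<^sub>R right_mult (Inr b) (right_mult (Inr a) w)" for a b
    using smult_stheta_stheta[OF assms(1)] by simp
  show ?thesis
    by (subst bivector_expansion[OF assms(2)])
      (simp only: linear_sum[OF linear_smult] linear_scale[OF linear_smult] eq
        sum_skew_coeff[of "\<lambda>a b. right_mult (Inr b) (right_mult (Inr a) w)" "\<lambda>B. v ({}, B, {#})", OF right_mult_right_mult[OF assms(1)]])
qed

lemma smult_form:
  assumes "finitary w" "v \<in> homog n r 0 2"
  shows "smult w v = (1/2) *\<^sub>R
    (\<Sum>a<r. \<Sum>b<r. skew_coeff (\<lambda>A. v (A, {}, {#})) a b *\<^sub>R right_mult (Inl b) (right_mult (Inl a) w))"
proof -
  have eq: "(if a < b then v ({a, b}, {}, {#}) else 0) *\<^sub>R smult w (smonom ({a, b}, {}, {#})) =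
      (if a < b then v ({a, b}, {}, {#}) else 0) *\<^sub>R right_mult (Inl b) (right_mult (Inl a) w)" for a b
    using smult_sxi_sxi[OF assms(1)] by simp
  show ?thesis
    by (subst form_expansion[OF assms(2)])
      (simp only: linear_sum[OF linear_smult] linear_scale[OF linear_smult] eq
        sum_skew_coeff[of "\<lambda>a b. right_mult (Inl b) (right_mult (Inl a) w)" "\<lambda>A. v (A, {}, {#})", OF right_mult_right_mult[OF assms(1)]])
qed

lemma ltheta_bivector:
  assumes v: "v \<in> homog n r 2 0"
  shows "ltheta a v = (\<Sum>b<r. skew_coeff (\<lambda>B. v ({}, B, {#})) a b *\<^sub>R stheta b)"
proof
  fix m :: smono
  obtain A B K where m: "m = (A, B, K)" by (cases m)
  have w: "(\<Sum>b<r. skew_coeff (\<lambda>B. v ({}, B, {#})) a b *\<^sub>R stheta b) m =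
      (\<Sum>b<r. if m = ({}, {b}, {#}) then skew_coeff (\<lambda>B. v ({}, B, {#})) a b else 0)"
    unfolding sum_fun_apply by (intro sum.cong refl) (simp add: smonom_def)
  show "ltheta a v m = (\<Sum>b<r. skew_coeff (\<lambda>B. v ({}, B, {#})) a b *\<^sub>R stheta b) m"
  proof (cases "\<exists>b<r. m = ({}, {b}, {#})")
    case True
    then obtain b where b: "b < r" "m = ({}, {b}, {#})" by blast
    show ?thesis
      unfolding w using b by (auto simp: ltheta_def skew_coeff_def Collect_conv_if)
  next
    case False
    have "ltheta a v m = 0"
    proof (rule ccontr)
      assume "ltheta a v m \<noteq> 0"
      then have "a \<notin> B" "v (A, insert a B, K) \<noteq> 0" by (auto simp: m ltheta_def split: if_splits)
      with homogD[OF v this(2)] have "A = {}" "K = {#}" "card B = 1" "B \<subseteq> {..<r}" by auto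
      then show False using False by (auto simp: m card_1_singleton_iff)
    qed
    then show ?thesis unfolding w using False by (simp add: sum.neutral)
  qed
qed

lemma lxi_form:
  assumes v: "v \<in> homog n r 0 2"
  shows "lxi a v = (\<Sum>b<r. skew_coeff (\<lambda>A. v (A, {}, {#})) a b *\<^sub>R sxi b)"
proof
  fix m :: smono
  obtain A B K where m: "m = (A, B, K)" by (cases m)
  have w: "(\<Sum>b<r. skew_coeff (\<lambda>A. v (A, {}, {#})) a b *\<^sub>R sxi b) m =
      (\<Sum>b<r. if m = ({b}, {}, {#}) then skew_coeff (\<lambda>A. v (A, {}, {#})) a b else 0)"
    unfolding sum_fun_apply by (intro sum.cong refl) (simp add: smonom_def)
  show "lxi a v m = (\<Sum>b<r. skew_coeff (\<lambda>A. v (A, {}, {#})) a b *\<^sub>R sxi b) m"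
  proof (cases "\<exists>b<r. m = ({b}, {}, {#})")
    case True
    then obtain b where b: "b < r" "m = ({b}, {}, {#})" by blast
    show ?thesis
      unfolding w using b by (auto simp: lxi_def skew_coeff_def Collect_conv_if)
  next
    case False
    have "lxi a v m = 0"
    proof (rule ccontr)
      assume "lxi a v m \<noteq> 0"
      then have "a \<notin> A" "v (insert a A, B, K) \<noteq> 0" by (auto simp: m lxi_def split: if_splits)
      with homogD[OF v this(2)] have "B = {}" "K = {#}" "card A = 1" "A \<subseteq> {..<r}" by auto
      then show False using False by (auto simp: m card_1_singleton_iff)
    qed
    then show ?thesis unfolding w using False by (simp add: sum.neutral)
  qed
qed

lemma lxi_eq_0: "lxi a v = 0" if v: "v \<in> homog n r k 0"
proof
  fix m show "lxi a v m = 0 m"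
    using homogD(5,6)[OF v, of "insert a (fst m)" "fst (snd m)" "snd (snd m)"]
    by (cases m) (auto simp: lxi_def)
qed

lemma ltheta_eq_0: "ltheta a v = 0" if v: "v \<in> homog n r 0 l"
proof
  fix m show "ltheta a v m = 0 m"
    using homogD(4,7)[OF v, of "fst m" "insert a (fst (snd m))" "snd (snd m)"]
    by (cases m) (auto simp: ltheta_def)
qed

text \<open>
  A bivector depends neither on \<open>\<xi>\<close> nor on the momenta. In the bracket with it only the right
  \<open>\<xi>\<close>-derivatives and the momentum derivatives of \<open>u\<close> survive, so the value at \<open>p\<close> depends on \<open>u p\<close>
  alone.
\<close>

lemma local_bracket_bivector:
  assumes u: "finitary (u p)" and v: "v p \<in> homog n r 2 0" and dv: "\<And>i. i < n \<Longrightarrow> dx c i v p \<in> homog n r 2 0"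
  shows "local_bracket n r c u v p =
    quad_bracket n r Inl Inr (skew_coeff (\<lambda>B. v p ({}, B, {#}))) (\<lambda>i. skew_coeff (\<lambda>B. dx c i v p ({}, B, {#}))) (u p)"
proof -
  have "local_bracket n r c u v p = (\<Sum>a<r. smult (right_deriv (Inl a) (u p)) (ltheta a (v p))) -
      (\<Sum>i<n. smult (dmom i (u p)) (dx c i v p))"
    by (rule ext) (simp add: local_bracket_def sum_fun_apply rxi_eq_right_deriv dmom_eq_0[OF v] lxi_eq_0[OF v]
        linear_0[OF linear_smult] sum_negf)
  then show ?thesis
    using u by (simp add: quad_bracket_def ltheta_bivector[OF v] smult_bivector[OF _ dv] smult_stheta
      linear_sum[OF linear_smult] linear_scale[OF linear_smult] scaleR_sum_right)
qed

lemma local_bracket_form: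
  assumes u: "finitary (u p)" and v: "v p \<in> homog n r 0 2" and dv: "\<And>i. i < n \<Longrightarrow> dx c i v p \<in> homog n r 0 2"
  shows "local_bracket n r c u v p =
    quad_bracket n r Inr Inl (skew_coeff (\<lambda>A. v p (A, {}, {#}))) (\<lambda>i. skew_coeff (\<lambda>A. dx c i v p (A, {}, {#}))) (u p)"
proof -
  have "local_bracket n r c u v p = (\<Sum>a<r. smult (right_deriv (Inr a) (u p)) (lxi a (v p))) -
      (\<Sum>i<n. smult (dmom i (u p)) (dx c i v p))"
    by (rule ext) (simp add: local_bracket_def sum_fun_apply rtheta_eq_right_deriv dmom_eq_0[OF v] ltheta_eq_0[OF v]
        linear_0[OF linear_smult] sum_negf)
  then show ?thesis
    using u by (simp add: quad_bracket_def lxi_form[OF v] smult_form[OF _ dv] smult_sxi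
      linear_sum[OF linear_smult] linear_scale[OF linear_smult] scaleR_sum_right)
qed

section \<open>Smooth functions in charts\<close>

text \<open>
  A partial derivative at \<open>x\<close> only sees the function near \<open>x\<close> on a coordinate line, and that part of the
  line lies in every open set around \<open>x\<close>. Identities between functions that hold on a chart
  can therefore be differentiated there, whatever the functions are outside.
\<close>

lemma eventually_line_in_open:
  assumes U: "openin (Euclidean_space n) U" and x: "x \<in> U" and i: "i < n"
  shows "\<forall>\<^sub>F t in nhds (x i). x(i := t) \<in> U"
proof -
  have "x \<in> topspace (Euclidean_space n)"
    using U x openin_subset by blast
  then have "continuous_map euclideanreal (Euclidean_space n) (\<lambda>t. x(i := t))"
    using i unfolding Euclidean_space_def topspace_Euclidean_space
    by (auto simp: continuous_map_in_subtopology continuous_map_componentwise_UNIV)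
  from openin_continuous_map_preimage[OF this U] have "open {t. x(i := t) \<in> U}"
    by simp
  then show ?thesis
    using x by (auto simp: eventually_nhds)
qed

lemma DERIV_transfer:
  "(f has_real_derivative D) (at x) \<Longrightarrow> \<forall>\<^sub>F t in nhds x. f t = g t \<Longrightarrow> (g has_real_derivative D) (at x)"
  using DERIV_cong_ev[OF refl, of f g x D D] by simp

text \<open>
  \<open>deriv\<close> commutes with negation only where the derivative exists, hence the induction uses the
  differentiability of each lower partial derivative on the whole open set.
\<close>

lemma foldr_partial_uminus:
  assumes U: "openin (Euclidean_space n) U" and f: "smooth_on n U f"
    and "is \<in> lists {..<n}" "x \<in> U"
  shows "foldr partial is (\<lambda>x. - f x) x = - foldr partial is f x"
  using assms(3,4)
proof (induction "is" arbitrary: x rule: lists.induct)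
  case (Cons i "is")
  let ?g = "\<lambda>t. foldr partial is f (x(i := t))"
  have i: "i < n" "is \<in> lists {..<n}"
    using Cons.hyps by auto
  have "?g differentiable at (x i)"
    using f i Cons.prems unfolding smooth_on_def by blast
  then have "((\<lambda>t. - ?g t) has_real_derivative - deriv ?g (x i)) (at (x i))"
    by (intro DERIV_minus) (simp add: DERIV_deriv_iff_real_differentiable)
  moreover have "\<forall>\<^sub>F t in nhds (x i). - ?g t = foldr partial is (\<lambda>x. - f x) (x(i := t))"
    using eventually_line_in_open[OF U Cons.prems i(1)] by eventually_elim (simp only: Cons.IH)
  ultimately have "((\<lambda>t. foldr partial is (\<lambda>x. - f x) (x(i := t))) has_real_derivative - deriv ?g (x i)) (at (x i))"
    by (rule DERIV_transfer)
  from DERIV_imp_deriv[OF this] show ?case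
    by (simp add: partial_def[of i])
qed auto

lemma smooth_on_uminus:
  assumes U: "openin (Euclidean_space n) U" and f: "smooth_on n U f"
  shows "smooth_on n U (\<lambda>x. - f x)"
  unfolding smooth_on_def
proof (intro ballI conjI allI impI)
  fix "is" assume "is": "is \<in> lists {..<n}"
  have "continuous_map (subtopology (Euclidean_space n) U) euclideanreal (\<lambda>x. - foldr partial is f x)"
    using f "is" by (auto simp: smooth_on_def)
  then show "continuous_map (subtopology (Euclidean_space n) U) euclideanreal (foldr partial is (\<lambda>x. - f x))"
    by (rule continuous_map_eq) (auto simp: foldr_partial_uminus[OF U f "is"])
  fix i x assume i: "i < n" and x: "x \<in> U"
  let ?g = "\<lambda>t. foldr partial is f (x(i := t))"
  have "?g differentiable at (x i)"
    using f i x "is" unfolding smooth_on_def by blast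
  then have "((\<lambda>t. - ?g t) has_real_derivative - deriv ?g (x i)) (at (x i))"
    by (intro DERIV_minus) (simp add: DERIV_deriv_iff_real_differentiable)
  moreover have "\<forall>\<^sub>F t in nhds (x i). - ?g t = foldr partial is (\<lambda>x. - f x) (x(i := t))"
    using eventually_line_in_open[OF U x i] by eventually_elim (simp add: foldr_partial_uminus[OF U f "is"])
  ultimately have "((\<lambda>t. foldr partial is (\<lambda>x. - f x) (x(i := t))) has_real_derivative - deriv ?g (x i)) (at (x i))"
    by (rule DERIV_transfer)
  then show "(\<lambda>t. foldr partial is (\<lambda>x. - f x) (x(i := t))) differentiable at (x i)"
    using real_differentiable_def by blast
qed

lemma chart_change_uminus: "chart_change n r c d p (\<lambda>m. - v m) = (\<lambda>m. - chart_change n r c d p v m)"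
  unfolding chart_change_def ssubst_def by (simp add: case_prod_unfold sum_negf)

lemma smooth_in_chart_uminus:
  assumes V: "smooth_vector_bundle V" and c: "c \<in> charts V"
    and f: "smooth_in_chart (bdim V) c (cdom c) f"
  shows "smooth_in_chart (bdim V) c (cdom c) (\<lambda>p. - f p)"
proof -
  have "openin (Euclidean_space (bdim V)) (coord c ` cdom c)"
    using V c by (simp add: smooth_vector_bundle_def)
  from smooth_on_uminus[OF this] f show ?thesis
    unfolding smooth_in_chart_def in_chart_def[abs_def] by blast
qed

lemma superfuns_uminus:
  assumes V: "smooth_vector_bundle V" and u: "u \<in> superfuns V"
  shows "(\<lambda>c p m. - u c p m) \<in> superfuns V"
proof -
  have change: "u d p = chart_change (bdim V) (vrank V) c d p (u c p)"
    if "c \<in> charts V" "d \<in> charts V" "p \<in> cdom c \<inter> cdom d" for c d p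
    using u that unfolding superfuns_def by blast
  have "(\<lambda>m. - u d p m) = chart_change (bdim V) (vrank V) c d p (\<lambda>m. - u c p m)"
    if "c \<in> charts V" "d \<in> charts V" "p \<in> cdom c \<inter> cdom d" for c d p
    unfolding chart_change_uminus by (subst change[OF that]) (rule refl)
  moreover have "smooth_in_chart (bdim V) c (cdom c) (\<lambda>p. - u c p m)" if "c \<in> charts V" for c m
    by (rule smooth_in_chart_uminus[OF V that]) (use u that in \<open>unfold superfuns_def, blast\<close>)
  moreover have "(\<lambda>m. - u c p m) = (\<lambda>m. 0)" if "c \<notin> charts V \<or> p \<notin> cdom c" for c p
  proof -
    have "u c p = (\<lambda>m. 0)" using u that unfolding superfuns_def by blast
    then show ?thesis by simp
  qed
  ultimately show ?thesis
    using u unfolding superfuns_def mem_Collect_eq neg_equal_0_iff_equal by (intro conjI) blast+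
qed

lemma has_derivative_in_chart:
  assumes "smooth_in_chart n c (cdom c) f" "p \<in> cdom c" "i < n"
  shows "((\<lambda>t. in_chart c f ((coord c p)(i := t))) has_real_derivative dcoord c i f p) (at (coord c p i))"
proof -
  have "[] \<in> lists {..<n}" by simp
  then have "(\<lambda>t. in_chart c f ((coord c p)(i := t))) differentiable at (coord c p i)"
    using assms unfolding smooth_in_chart_def smooth_on_def by (metis foldr.simps(1) id_apply imageI)
  then show ?thesis
    by (simp add: dcoord_def partial_def DERIV_deriv_iff_real_differentiable)
qed

lemma dx_homog:
  assumes "\<And>q. u q \<in> homog n r k l"
  shows "dx c i u p \<in> homog n r k l"
proof -
  have "dx c i u p m = 0" if "\<And>q. u q m = 0" for m
    using that by (simp add: dx_def dcoord_def partial_def in_chart_def)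
  then show ?thesis
    using assms unfolding homog_def by blast
qed

lemma has_derivative_skew_coeff:
  assumes smooth: "\<And>m. smooth_in_chart n c (cdom c) (\<lambda>q. u q m)" and p: "p \<in> cdom c" and i: "i < n"
  shows "((\<lambda>t. in_chart c (\<lambda>q. skew_coeff (\<lambda>S. u q (g S)) a b) ((coord c p)(i := t)))
    has_real_derivative skew_coeff (\<lambda>S. dx c i u p (g S)) a b) (at (coord c p i))"
proof -
  note * = has_derivative_in_chart[OF smooth p i, of "g {a, b}"]
  consider "a < b" | "b < a" | "a = b" by linarith
  then show ?thesis
    using * DERIV_minus[OF *] by cases (simp_all add: skew_coeff_def dx_def in_chart_def)
qed

text \<open>
  The product of the two matrices is constant on the part of the \<open>i\<close>-th coordinate line that lies in
  the chart, so its derivative, given by the product rule, is 0. For the matrices of \<open>\<sigma>\<close> and \<open>-\<tau>\<close>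
  this makes the momentum terms of the commutator cancel.
\<close>

lemma derivative_of_inverse_relation:
  assumes V: "smooth_vector_bundle V" and c: "c \<in> charts V" and p: "p \<in> cdom c" and i: "i < bdim V"
    and smooth: "\<And>m. smooth_in_chart (bdim V) c (cdom c) (\<lambda>q. u q m)"
      "\<And>m. smooth_in_chart (bdim V) c (cdom c) (\<lambda>q. v q m)"
    and const: "\<And>q. q \<in> cdom c \<Longrightarrow>
      (\<Sum>b<r. skew_coeff (\<lambda>S. u q (g S)) a b * skew_coeff (\<lambda>S. v q (h S)) b d) = k"
  shows "(\<Sum>b<r. skew_coeff (\<lambda>S. dx c i u p (g S)) a b * skew_coeff (\<lambda>S. v p (h S)) b d +
    skew_coeff (\<lambda>S. u p (g S)) a b * skew_coeff (\<lambda>S. dx c i v p (h S)) b d) = 0"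
proof -
  let ?x = "coord c p"
  let ?u = "\<lambda>b t. in_chart c (\<lambda>q. skew_coeff (\<lambda>S. u q (g S)) a b) (?x(i := t))"
  let ?v = "\<lambda>b t. in_chart c (\<lambda>q. skew_coeff (\<lambda>S. v q (h S)) b d) (?x(i := t))"
  have chart: "openin (Euclidean_space (bdim V)) (coord c ` cdom c)" "openin (base V) (cdom c)"
    "homeomorphic_map (subtopology (base V) (cdom c))
          (subtopology (Euclidean_space (bdim V)) (coord c ` cdom c)) (coord c)"
    using V c by (auto simp: smooth_vector_bundle_def)
  then have "inj_on (coord c) (cdom c)"
    using homeomorphic_imp_injective_map[OF chart(3)] openin_subset[OF chart(2)]
    by (simp add: Int_absorb1)
  then have at_p: "in_chart c f ?x = f p" for f
    using p by (simp add: in_chart_def)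
  have "\<forall>\<^sub>F t in nhds (?x i). (\<Sum>b<r. ?u b t * ?v b t) = k"
    using eventually_line_in_open[OF chart(1) imageI[OF p] i]
    by eventually_elim (simp add: in_chart_def const inv_into_into)
  then have "((\<lambda>t. \<Sum>b<r. ?u b t * ?v b t) has_real_derivative 0) (at (?x i))"
    using DERIV_cong_ev[OF refl _ refl, of "\<lambda>t. \<Sum>b<r. ?u b t * ?v b t" "\<lambda>_. k" "?x i" 0] by simp
  moreover have "((\<lambda>t. \<Sum>b<r. ?u b t * ?v b t) has_real_derivative
      (\<Sum>b<r. skew_coeff (\<lambda>S. dx c i u p (g S)) a b * ?v b (?x i) +
        skew_coeff (\<lambda>S. dx c i v p (h S)) b d * ?u b (?x i))) (at (?x i))"
    by (intro DERIV_sum DERIV_mult has_derivative_skew_coeff[where n = "bdim V"] smooth p i)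
  ultimately have "(\<Sum>b<r. skew_coeff (\<lambda>S. dx c i u p (g S)) a b * ?v b (?x i) +
        skew_coeff (\<lambda>S. dx c i v p (h S)) b d * ?u b (?x i)) = 0"
    using DERIV_unique by blast
  then show ?thesis by (simp add: at_p mult.commute)
qed

section \<open>The matrices of a bivector and its inverse\<close>

lemma fibre_closed:
  assumes "smooth_vector_bundle V" "c \<in> charts V" "p \<in> cdom c"
  shows "X \<in> fibre V p \<Longrightarrow> Y \<in> fibre V p \<Longrightarrow> X + Y \<in> fibre V p"
    and "X \<in> fibre V p \<Longrightarrow> t *\<^sub>R X \<in> fibre V p"
proof -
  have "fibre V p = span (frame_set (vrank V) c p)"
    using assms unfolding smooth_vector_bundle_def by blast
  then show "X \<in> fibre V p \<Longrightarrow> Y \<in> fibre V p \<Longrightarrow> X + Y \<in> fibre V p"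
    "X \<in> fibre V p \<Longrightarrow> t *\<^sub>R X \<in> fibre V p"
    by (auto intro: span_add span_scale)
qed

text \<open>
  Evaluate \<open>\<tau>\<^sup>\<flat> (\<sigma>\<^sup>\<sharp> \<xi>\<^sup>a) = \<xi>\<^sup>a\<close> on the \<open>d\<close>-th vector of the frame. The sign is the one in
  \<open>\<tau>\<^sup>\<flat> X = - i\<^sub>X \<tau>\<close>: the matrices of \<open>\<sigma>\<close> and \<open>-\<tau>\<close> are inverse to each other.
\<close>

lemma matrix_inverse_relation:
  assumes V: "smooth_vector_bundle V" and nd: "nondegenerate_bivector V \<sigma>" and inv: "is_inverse_form V \<sigma> \<tau>"
    and c: "c \<in> charts V" and p: "p \<in> cdom c" and a: "a < vrank V" and d: "d < vrank V"
  shows "(\<Sum>b<vrank V. bivector_matrix \<sigma> c p a b * form_matrix \<tau> c p b d) = (if a = d then - 1 else 0)"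
proof -
  let ?r = "vrank V" and ?B = "frame_set (vrank V) c p"
  have fr: "inj_on (\<lambda>a. frame c a p) {..<?r}" "independent ?B" "span ?B = fibre V p"
    using V c p by (auto simp: smooth_vector_bundle_def)
  have in_span: "frame c b p \<in> span ?B" if "b < ?r" for b
    using that by (auto simp: frame_set_def intro: span_base)
  then have in_fibre: "frame c b p \<in> fibre V p" if "b < ?r" for b
    using that fr(3) by simp
  have coframe_frame: "coframe ?r c b p (frame c e p) = (if b = e then 1 else 0)"
    if "b < ?r" "e < ?r" for b e
    using that representation_basis[OF fr(2), of "frame c e p"] inj_onD[OF fr(1), of b e]
    by (auto simp: coframe_def frame_set_def)
  \<comment> \<open>The covector \<open>\<xi>\<^sup>a\<close>, made extensional as an element of the dual fibre.\<close>
  define \<alpha> where "\<alpha> = restrict (coframe ?r c a p) (fibre V p)"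
  have \<alpha>: "\<alpha> \<in> dual_fibre V p"
    using fr(2,3) fibre_closed[OF V c p]
    by (auto simp: \<alpha>_def dual_fibre_def coframe_def representation_add representation_scale)
  let ?X = "sharp V \<sigma> c p \<alpha>"
  have X: "?X = (\<Sum>b<?r. bivector_matrix \<sigma> c p a b *\<^sub>R frame c b p)"
  proof -
    have "?X = (\<Sum>e<?r. if e = a then \<Sum>b<?r. bivector_matrix \<sigma> c p a b *\<^sub>R frame c b p else 0)"
      unfolding sharp_def by (intro sum.cong refl) (auto simp: \<alpha>_def in_fibre coframe_frame a)
    then show ?thesis using a by simp
  qed
  have coX: "coframe ?r c b p ?X = bivector_matrix \<sigma> c p a b" if "b < ?r" for b
  proof -
    have "coframe ?r c b p ?X = (\<Sum>e<?r. bivector_matrix \<sigma> c p a e * coframe ?r c b p (frame c e p))"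
      unfolding X coframe_def
      by (subst representation_sum[OF fr(2)])
        (auto simp: representation_scale[OF fr(2) in_span] intro!: span_scale in_span)
    also have "\<dots> = (\<Sum>e<?r. if e = b then bivector_matrix \<sigma> c p a e else 0)"
      using that by (intro sum.cong refl) (auto simp: coframe_frame)
    finally show ?thesis using that by simp
  qed
  have bij: "bij_betw (sharp V \<sigma> c p) (dual_fibre V p) (fibre V p)"
    using nd c p by (auto simp: nondegenerate_bivector_def)
  then have "?X \<in> fibre V p"
    using \<alpha> by (auto simp: bij_betw_def)
  then have "flat V \<tau> c p ?X = \<alpha>"
    using inv c p \<alpha> bij by (simp add: is_inverse_form_def bij_betw_def)
  then have "flat V \<tau> c p ?X (frame c d p) = (if a = d then 1 else 0)"
    using a d by (simp add: \<alpha>_def in_fibre coframe_frame)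
  moreover have "(\<Sum>e<?r. coframe ?r c b p ?X * form_matrix \<tau> c p b e * coframe ?r c e p (frame c d p)) =
      bivector_matrix \<sigma> c p a b * form_matrix \<tau> c p b d" if "b < ?r" for b
  proof -
    have "(\<Sum>e<?r. coframe ?r c b p ?X * form_matrix \<tau> c p b e * coframe ?r c e p (frame c d p)) =
        (\<Sum>e<?r. if e = d then bivector_matrix \<sigma> c p a b * form_matrix \<tau> c p b e else 0)"
      using that d by (intro sum.cong refl) (auto simp: coX coframe_frame)
    then show ?thesis using d by simp
  qed
  ultimately show ?thesis using d in_fibre by (simp add: flat_def split: if_splits)
qed

lemma form_matrix_uminus: "form_matrix (\<lambda>c p m. - \<tau> c p m) c p a b = - form_matrix \<tau> c p a b"
  by (simp add: form_matrix_def)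

lemma nondegenerate_form_uminus_inverse:
  assumes V: "smooth_vector_bundle V" and nd: "nondegenerate_bivector V \<sigma>" and inv: "is_inverse_form V \<sigma> \<tau>"
  shows "nondegenerate_form V (\<lambda>c p m. - \<tau> c p m)"
  unfolding nondegenerate_form_def
proof (intro ballI)
  fix c p assume c: "c \<in> charts V" "p \<in> cdom c"
  let ?neg = "\<lambda>\<alpha>. restrict (\<lambda>Y. - \<alpha> Y :: real) (fibre V p)"
  have "bij_betw (inv_into (dual_fibre V p) (sharp V \<sigma> c p)) (fibre V p) (dual_fibre V p)"
    using nd c by (auto simp: nondegenerate_bivector_def intro: bij_betw_inv_into)
  then have "bij_betw (flat V \<tau> c p) (fibre V p) (dual_fibre V p)"
    using inv c by (subst bij_betw_cong) (auto simp: is_inverse_form_def)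
  moreover have neg: "?neg \<alpha> \<in> dual_fibre V p" "?neg (?neg \<alpha>) = \<alpha>" if "\<alpha> \<in> dual_fibre V p" for \<alpha>
    using that fibre_closed[OF V c] by (auto simp: dual_fibre_def extensional_def fun_eq_iff)
  then have "bij_betw ?neg (dual_fibre V p) (dual_fibre V p)"
    by (intro bij_betw_byWitness[where f' = ?neg]) auto
  ultimately have "bij_betw (?neg \<circ> flat V \<tau> c p) (fibre V p) (dual_fibre V p)"
    by (rule bij_betw_trans)
  moreover have "?neg \<circ> flat V \<tau> c p = flat V (\<lambda>c p m. - \<tau> c p m) c p"
    by (auto simp: fun_eq_iff flat_def form_matrix_uminus sum_negf)
  ultimately show "bij_betw (flat V (\<lambda>c p m. - \<tau> c p m) c p) (fibre V p) (dual_fibre V p)"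
    by simp
qed

section \<open>Poisson functions and symplectic functions\<close>

lemma superfun_homog:
  assumes u: "u \<in> superfuns V" "has_shifted_bidegree (int k - 1, int l - 1) u" and c: "c \<in> charts V"
  shows "u c p \<in> homog (bdim V) (vrank V) k l"
proof -
  have "valid_mono (bdim V) (vrank V) m \<and> bidegree m = (k, l)" if m: "u c p m \<noteq> 0" for m
  proof
    have "p \<in> cdom c"
    proof (rule ccontr)
      assume "p \<notin> cdom c"
      then have "u c p = (\<lambda>m. 0)" using u(1) unfolding superfuns_def by blast
      then show False using m by simp
    qed
    then show "valid_mono (bdim V) (vrank V) m"
      using u(1) c m unfolding superfuns_def by blast
    have "shifted_bidegree m = (int k - 1, int l - 1)"
      using u(2) m unfolding has_shifted_bidegree_def by blast
    then show "bidegree m = (k, l)"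
      by (simp add: shifted_bidegree_def prod_eq_iff)
  qed
  then show ?thesis by (simp add: homog_def)
qed

lemma component_homog:
  assumes S: "S \<in> superfuns V" and c: "c \<in> charts V" "p \<in> cdom c"
  shows "component (int k - 1, int l - 1) S c p \<in> homog (bdim V) (vrank V) k l"
proof -
  have "valid_mono (bdim V) (vrank V) m" if "S c p m \<noteq> 0" for m
    using S c that unfolding superfuns_def by blast
  then show ?thesis
    by (auto simp: homog_def component_def shifted_bidegree_def prod_eq_iff)
qed

lemma big_bracket_bivector:
  assumes \<sigma>: "bivector V \<sigma>" and c: "c \<in> charts V" "p \<in> cdom c" and u: "finitary (u c p)"
  shows "big_bracket V u \<sigma> c p = quad_bracket (bdim V) (vrank V) Inl Inr (skew_coeff (\<lambda>B. \<sigma> c p ({}, B, {#})))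
    (\<lambda>i. skew_coeff (\<lambda>B. dx c i (\<sigma> c) p ({}, B, {#}))) (u c p)"
proof -
  have "\<sigma> c q \<in> homog (bdim V) (vrank V) 2 0" for q
    using superfun_homog[of \<sigma> V 2 0 c q] \<sigma> c by (simp add: bivector_def)
  then show ?thesis
    unfolding big_bracket_def using c
    by (simp add: local_bracket_bivector[where u = "u c" and v = "\<sigma> c", OF u] dx_homog)
qed

lemma big_bracket_form:
  assumes \<tau>: "two_form V \<tau>" and c: "c \<in> charts V" "p \<in> cdom c" and u: "finitary (u c p)"
  shows "big_bracket V u \<tau> c p = quad_bracket (bdim V) (vrank V) Inr Inl (skew_coeff (\<lambda>A. \<tau> c p (A, {}, {#})))
    (\<lambda>i. skew_coeff (\<lambda>A. dx c i (\<tau> c) p (A, {}, {#}))) (u c p)"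
proof -
  have "\<tau> c q \<in> homog (bdim V) (vrank V) 0 2" for q
    using superfun_homog[of \<tau> V 0 2 c q] \<tau> c by (simp add: two_form_def)
  then show ?thesis
    unfolding big_bracket_def using c
    by (simp add: local_bracket_form[where u = "u c" and v = "\<tau> c", OF u] dx_homog)
qed

text \<open>
  The equivalence at one point of a chart. The inverse relation is needed on the whole chart domain,
  as it has to be differentiated.
\<close>

lemma poisson_iff_presymplectic_at:
  fixes V :: "('m, 'v::real_vector) vbundle"
  assumes V: "smooth_vector_bundle V" and S: "S \<in> superfuns V"
    and \<sigma>: "bivector V \<sigma>" and \<tau>: "two_form V \<tau>" and c: "c \<in> charts V" "p \<in> cdom c"
    and inv: "\<And>q a d. q \<in> cdom c \<Longrightarrow> a < vrank V \<Longrightarrow> d < vrank V \<Longrightarrow>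
      (\<Sum>b<vrank V. bivector_matrix \<sigma> c q a b * form_matrix \<tau> c q b d) = (if a = d then 1 else 0)"
  defines "\<phi> \<equiv> component (2, -1) S" and "\<gamma> \<equiv> component (1, 0) S"
    and "\<mu> \<equiv> component (0, 1) S" and "\<psi> \<equiv> component (-1, 2) S" and "br \<equiv> big_bracket V"
  shows "(\<forall>m. \<phi> c p m - br \<gamma> \<sigma> c p m + 1/2 * br (br \<mu> \<sigma>) \<sigma> c p m - 1/6 * br (br (br \<psi> \<sigma>) \<sigma>) \<sigma> c p m = 0) \<longleftrightarrow>
    (\<forall>m. \<psi> c p m - br \<mu> \<tau> c p m + 1/2 * br (br \<gamma> \<tau>) \<tau> c p m - 1/6 * br (br (br \<phi> \<tau>) \<tau>) \<tau> c p m = 0)"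
proof -
  let ?n = "bdim V" and ?r = "vrank V"
  define s where "s q = skew_coeff (\<lambda>B. \<sigma> c q ({}, B, {#}))" for q
  define t where "t q = skew_coeff (\<lambda>A. \<tau> c q (A, {}, {#}))" for q
  define ds where "ds i = skew_coeff (\<lambda>B. dx c i (\<sigma> c) p ({}, B, {#}))" for i
  define dt where "dt i = skew_coeff (\<lambda>A. dx c i (\<tau> c) p (A, {}, {#}))" for i
  define E where "E = quad_bracket ?n ?r Inl Inr (s p) ds"
  define F where "F = quad_bracket ?n ?r Inr Inl (t p) dt"
  have st: "(\<Sum>b<?r. s q a b * t q b d) = (if a = d then 1 else 0)" if "q \<in> cdom c" "a < ?r" "d < ?r" for q a d
    using inv[OF that] by (simp add: s_def t_def skew_coeff_def bivector_matrix_def form_matrix_def)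
  have dst: "(\<Sum>b<?r. ds i a b * t p b d + s p a b * dt i b d) = 0" if "i < ?n" "a < ?r" "d < ?r" for i a d
    unfolding ds_def dt_def s_def t_def
  proof (rule derivative_of_inverse_relation[OF V c that(1)])
    show "smooth_in_chart ?n c (cdom c) (\<lambda>q. \<sigma> c q m)" "smooth_in_chart ?n c (cdom c) (\<lambda>q. \<tau> c q m)" for m
      using \<sigma> \<tau> c unfolding bivector_def two_form_def superfuns_def by blast+
    show "(\<Sum>b<?r. skew_coeff (\<lambda>B. \<sigma> c q ({}, B, {#})) a b * skew_coeff (\<lambda>A. \<tau> c q (A, {}, {#})) b d) =
        (if a = d then 1 else 0)" if "q \<in> cdom c" for q
      using st[OF that \<open>a < ?r\<close> \<open>d < ?r\<close>] by (simp add: s_def t_def)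
  qed
  have comm: "E (F u) - F (E u) = (real k - real l) *\<^sub>R u" if "u \<in> homog ?n ?r k l" for u k l
    unfolding E_def F_def number_operators[OF that, symmetric]
    by (rule quad_bracket_commutator[OF homog_finitary[OF that]])
      (use st c dst in \<open>auto simp: s_def t_def ds_def dt_def intro: skew_coeff_swap\<close>)
  have S': "\<phi> c p \<in> homog ?n ?r 3 0" "\<gamma> c p \<in> homog ?n ?r 2 1" "\<mu> c p \<in> homog ?n ?r 1 2" "\<psi> c p \<in> homog ?n ?r 0 3"
    using component_homog[OF S c, of 3 0] component_homog[OF S c, of 2 1]
      component_homog[OF S c, of 1 2] component_homog[OF S c, of 0 3]
    by (simp_all add: \<phi>_def \<gamma>_def \<mu>_def \<psi>_def)
  have brE: "br u \<sigma> c p = E (u c p)" and brF: "br u \<tau> c p = F (u c p)" if "finitary (u c p)" for u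
    unfolding br_def E_def F_def s_def t_def ds_def[abs_def] dt_def[abs_def]
    using that \<sigma> \<tau> c by (simp_all add: big_bracket_bivector big_bracket_form)
  have fin: "finitary (E u)" "finitary (F u)" if "finitary u" for u
    using that by (simp_all add: E_def F_def)
  note fin' = S'[THEN homog_finitary]
  have "\<phi> c p - E (\<gamma> c p) + (1/2) *\<^sub>R E (E (\<mu> c p)) - (1/6) *\<^sub>R E (E (E (\<psi> c p))) = 0 \<longleftrightarrow>
      \<psi> c p - F (\<mu> c p) + (1/2) *\<^sub>R F (F (\<gamma> c p)) - (1/6) *\<^sub>R F (F (F (\<phi> c p))) = 0"
    by (rule top_zero_iff_bottom_zero[where U = "homog ?n ?r"])
      (use S' comm in \<open>auto simp: E_def F_def linear_quad_bracket quad_bracket_xi_theta_homog quad_bracket_theta_xi_homog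
        quad_bracket_xi_theta_eq_0 quad_bracket_theta_xi_eq_0\<close>)
  then show ?thesis
    by (simp add: brE brF fin fin' fun_eq_iff)
qed

theorem theorem4p2:
  fixes V :: "('m, 'v::real_vector) vbundle"
    and S \<sigma> \<tau> :: "('m, 'v) superfun"
  assumes "smooth_vector_bundle V"
    and "structure_on V S"
    and "bivector V \<sigma>" and "nondegenerate_bivector V \<sigma>"
    and "two_form V \<tau>" and "is_inverse_form V \<sigma> \<tau>"
  shows "poisson_function V S \<sigma> \<longleftrightarrow> symplectic_function V S (\<lambda>c p m. - \<tau> c p m)"
proof -
  let ?\<tau> = "\<lambda>c p m. - \<tau> c p m"
  have S: "S \<in> superfuns V"
    using assms(2) by (simp add: structure_on_def)
  have \<tau>: "two_form V ?\<tau>"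
    using assms(1,5) by (simp add: two_form_def superfuns_uminus has_shifted_bidegree_def)
  have inv: "(\<Sum>b<vrank V. bivector_matrix \<sigma> c q a b * form_matrix ?\<tau> c q b d) = (if a = d then 1 else 0)"
    if "c \<in> charts V" "q \<in> cdom c" "a < vrank V" "d < vrank V" for c q a d
    using matrix_inverse_relation[OF assms(1,4,6) that] by (auto simp: form_matrix_uminus sum_negf split: if_splits)
  have outside: "component kl S c p m = 0" "big_bracket V u v c p m = 0"
    if "\<not> (c \<in> charts V \<and> p \<in> cdom c)" for kl c p m u v
  proof -
    \<comment> \<open>A superfunction is 0 by convention away from the chart domains.\<close>
    have "S c p = (\<lambda>m. 0)" using S that unfolding superfuns_def by blast
    then show "component kl S c p m = 0" by (simp add: component_def)
    show "big_bracket V u v c p m = 0" using that by (auto simp: big_bracket_def)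
  qed
  let ?P = "\<lambda>c p. \<forall>m. component (2, -1) S c p m - big_bracket V (component (1, 0) S) \<sigma> c p m
      + 1/2 * big_bracket V (big_bracket V (component (0, 1) S) \<sigma>) \<sigma> c p m
      - 1/6 * big_bracket V (big_bracket V (big_bracket V (component (-1, 2) S) \<sigma>) \<sigma>) \<sigma> c p m = 0"
  let ?Q = "\<lambda>c p. \<forall>m. component (-1, 2) S c p m - big_bracket V (component (0, 1) S) ?\<tau> c p m
      + 1/2 * big_bracket V (big_bracket V (component (1, 0) S) ?\<tau>) ?\<tau> c p m
      - 1/6 * big_bracket V (big_bracket V (big_bracket V (component (2, -1) S) ?\<tau>) ?\<tau>) ?\<tau> c p m = 0"
  have "?P c p \<longleftrightarrow> ?Q c p" for c p
  proof (cases "c \<in> charts V \<and> p \<in> cdom c")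
    case True
    then have c: "c \<in> charts V" "p \<in> cdom c" by auto
    show ?thesis
      using poisson_iff_presymplectic_at[OF assms(1) S assms(3) \<tau> c inv[OF c(1)]] .
  next
    case False
    show ?thesis by (simp add: outside[OF False])
  qed
  then have "(\<forall>c p. ?P c p) \<longleftrightarrow> (\<forall>c p. ?Q c p)" by (simp only:)
  moreover have "poisson_function V S \<sigma> \<longleftrightarrow> (\<forall>c p. ?P c p)"
    using assms(3) by (simp only: poisson_function_def Let_def simp_thms)
  moreover have "symplectic_function V S ?\<tau> \<longleftrightarrow> (\<forall>c p. ?Q c p)"
    using \<tau> nondegenerate_form_uminus_inverse[OF assms(1,4,6)]
    by (simp only: symplectic_function_def presymplectic_function_def Let_def simp_thms)
  ultimately show ?thesis by (simp only:)
qed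

end
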